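(* Let $X_1,X_2$ be Polish spaces, $c:X_1\times X_2\to[0,+\infty]$ lower semicontinuous and not identically $+\infty$, and $\mathbf M_i\in\mathcal P(\mathcal P(X_i))$, $i=1,2$. Let $\mathbf P\in R\Gamma(\mathbf M_1,\mathbf M_2)$ and $\Pi:=(\mathrm{pr}^1_\sharp,\mathrm{pr}^2_\sharp)_\sharp\mathbf P\in\mathcal P(\mathcal P(X_1)\times\mathcal P(X_2))$. Then $\Pi\in\Gamma(\mathbf M_1,\mathbf M_2)$ and $$\int_{\mathcal P(X_1)\times\mathcal P(X_2)}\mathsf C(\mu_1,\mu_2)\,d\Pi(\mu_1,\mu_2)\le\int_{\mathcal P(X_1\times X_2)}\int_{X_1\times X_2}c(x_1,x_2)\,d\pi(x_1,x_2)\,d\mathbf P(\pi).$$ Moreover, the following equality holds and the minimum (possibly infinite) is always attained: $$\mathcal C(\mathbf M_1,\mathbf M_2)=\min\Big\{\int_{\mathcal P(X_1\times X_2)}\int_{X_1\times X_2}c\,d\pi\,d\mathbf P(\pi)\ :\ \mathbf P\in R\Gamma(\mathbf M_1,\mathbf M_2)\Big\}.$$ If $\mathcal C(\mathbf M_1,\mathbf M_2)<+\infty$, then a random coupling $\mathbf P\in R\Gamma(\mathbf M_1,\mathbf M_2)$ is optimal (i.e. attains this minimum) if and only if $(\mathrm{pr}^1_\sharp,\mathrm{pr}^2_\sharp)_\sharp\mathbf P\in\Gamma_{o,\mathsf C}(\mathbf M_1,\mathbf M_2)$ and $\mathbf P$ is concentrated on the set of optimal couplings $\mathcal P_{o,\mathsf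 C}(X_1\times X_2)$.
   Context: $\mathcal P(Y)$ is the set of Borel probability measures on a Polish space $Y$ with the narrow topology (Polish). $\Gamma(\cdot,\cdot)$ is the set of couplings, $\mathrm{pr}^i$ projections, $f_{\sharp\sharp}:=(f_\sharp)_\sharp$. $\mathsf C(\mu_1,\mu_2):=\min_{\pi\in\Gamma(\mu_1,\mu_2)}\int c\,d\pi$ for $\mu_i\in\mathcal P(X_i)$; $\mathcal C(\mathbf M_1,\mathbf M_2):=\min_{\Pi\in\Gamma(\mathbf M_1,\mathbf M_2)}\int\mathsf C\,d\Pi$, and $\Gamma_{o,\mathsf C}(\mathbf M_1,\mathbf M_2)$ is the set of its minimizers. $R\Gamma(\mathbf M_1,\mathbf M_2)$ (laws of random couplings) is the set of $\mathbf P\in\mathcal P(\mathcal P(X_1\times X_2))$ with $\mathrm{pr}^1_{\sharp\sharp}\mathbf P=\mathbf M_1$ and $\mathrm{pr}^2_{\sharp\sharp}\mathbf P=\mathbf M_2$. $\mathcal P_{o,\mathsf C}(X_1\times X_2)$ is the set of $\pi\in\mathcal P(X_1\times X_2)$ that are optimal between their marginals, i.e. $\int c\,d\pi=\mathsf C(\mathrm{pr}^1_\sharp\pi,\mathrm{pr}^2_\sharp\pi)$. *)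

theory Defs
  imports "HOL-Probability.Probability"
begin

text \<open>
  Borel probability measures form a type with its own topology, so that
  \<open>'a borel_prob borel_prob\<close> is the space of laws of random measures.  The type
  argument is only assumed to be a topological space: the construction has to be applied
  a second time, to a space of measures.
\<close>

typedef (overloaded) 'a borel_prob =
  "{M :: 'a::topological_space measure. sets M = sets borel \<and> prob_space M}"
  morphisms to_measure Abs_borel_prob
  by (rule exI[of _ "return borel undefined"]) (simp add: prob_space_return)

lemma sets_to_measure [simp, measurable_cong]: "sets (to_measure \<mu>) = sets borel"
  using to_measure[of \<mu>] by simp

lemma space_to_measure [simp]: "space (to_measure \<mu>) = UNIV"
  using sets_eq_imp_space_eq[OF sets_to_measure] by simp

lemma prob_space_to_measure [simp, intro]: "prob_space (to_measure \<mu>)"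
  using to_measure[of \<mu>] by simp

text \<open>
  The narrow topology: the coarsest one that makes \<open>\<mu> \<mapsto> \<integral> f d\<mu>\<close> continuous for every
  bounded continuous real function \<open>f\<close>.
\<close>

instantiation borel_prob :: (topological_space) topological_space
begin

definition open_borel_prob :: "'a borel_prob set \<Rightarrow> bool" where
  "open_borel_prob = generate_topology
     {{\<mu>. (\<integral>x. f x \<partial>to_measure \<mu>) \<in> U} | (f :: 'a \<Rightarrow> real) U.
        continuous_on UNIV f \<and> bounded (range f) \<and> open U}"

instance
  using topological_space_generate_topology
  by intro_classes (auto intro: generate_topology.intros simp: open_borel_prob_def)

end

text \<open>The push-forward; it is meaningful only for Borel measurable \<open>f\<close>.\<close>

definition pushforward ::
    "('a::topological_space \<Rightarrow> 'b::topological_space) \<Rightarrow> 'a borel_prob \<Rightarrow> 'b borel_prob" where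
  "pushforward f \<mu> = Abs_borel_prob (distr (to_measure \<mu>) borel f)"

lemma to_measure_pushforward:
  assumes "f \<in> borel_measurable borel"
  shows "to_measure (pushforward f \<mu>) = distr (to_measure \<mu>) borel f"
  unfolding pushforward_def
proof (rule Abs_borel_prob_inverse)
  have "f \<in> measurable (to_measure \<mu>) borel"
    using assms by (simp cong: measurable_cong_sets)
  then show "distr (to_measure \<mu>) borel f \<in> {M. sets M = sets borel \<and> prob_space M}"
    by (simp add: prob_space.prob_space_distr)
qed

lemma continuous_on_pushforward:
  fixes f :: "'a::topological_space \<Rightarrow> 'b::topological_space"
  assumes f: "continuous_on UNIV f"
  shows "continuous_on UNIV (pushforward f)"
proof -
  have fm: "f \<in> borel_measurable borel"
    using f by (rule borel_measurable_continuous_onI)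
  have "open (pushforward f -` A)" if "open A" for A
  proof -
    have "generate_topology
       {{\<mu>. (\<integral>x. g x \<partial>to_measure \<mu>) \<in> U} | (g :: 'b \<Rightarrow> real) U.
          continuous_on UNIV g \<and> bounded (range g) \<and> open U} A"
      using that by (simp add: open_borel_prob_def)
    then show ?thesis
    proof induction
      case (Basis S)
      then obtain g :: "'b \<Rightarrow> real" and U where S: "S = {\<mu>. (\<integral>x. g x \<partial>to_measure \<mu>) \<in> U}"
        and g: "continuous_on UNIV g" "bounded (range g)" and U: "open U" by blast
      have gm: "g \<in> borel_measurable borel"
        using g(1) by (rule borel_measurable_continuous_onI)
      have "pushforward f -` S = {\<mu>. (\<integral>x. (g \<circ> f) x \<partial>to_measure \<mu>) \<in> U}"
        using fm gm by (auto simp: S to_measure_pushforward integral_distr cong: measurable_cong_sets)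
      moreover have "continuous_on UNIV (g \<circ> f)"
        using f g(1) by (meson continuous_on_compose continuous_on_subset subset_UNIV)
      moreover have "bounded (range (g \<circ> f))"
        using g(2) by (rule bounded_subset) auto
      ultimately show ?case
        unfolding open_borel_prob_def using U by (intro generate_topology.Basis) blast
    qed (auto simp: vimage_Union)
  qed
  then show ?thesis
    by (simp add: continuous_on_open_vimage)
qed

definition lower_semicontinuous :: "('a::topological_space \<Rightarrow> ennreal) \<Rightarrow> bool" where
  "lower_semicontinuous f \<longleftrightarrow> (\<forall>x t. t < f x \<longrightarrow> (\<forall>\<^sub>F y in nhds x. t < f y))"

definition couplings ::
    "'a::topological_space borel_prob \<Rightarrow> 'b::topological_space borel_prob \<Rightarrow> ('a \<times> 'b) borel_prob set"
  where
  "couplings \<mu> \<nu> = {\<pi>. pushforward fst \<pi> = \<mu> \<and> pushforward snd \<pi> = \<nu>}"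

abbreviation plan_cost ::
    "('a::topological_space \<Rightarrow> ennreal) \<Rightarrow> 'a borel_prob \<Rightarrow> ennreal" where
  "plan_cost c \<pi> \<equiv> \<integral>\<^sup>+z. c z \<partial>to_measure \<pi>"

text \<open>
  The optimal transport cost is the infimum in \<open>[0, \<infinity>]\<close>, a total operation; the infimum is a
  minimum when \<open>c\<close> is lower semicontinuous on a product of Polish spaces.
\<close>

definition ot_cost ::
    "('a::topological_space \<times> 'b::topological_space \<Rightarrow> ennreal) \<Rightarrow>
      'a borel_prob \<Rightarrow> 'b borel_prob \<Rightarrow> ennreal" where
  "ot_cost c \<mu> \<nu> = (INF \<pi>\<in>couplings \<mu> \<nu>. plan_cost c \<pi>)"

definition optimal_couplings ::
    "('a::topological_space \<times> 'b::topological_space \<Rightarrow> ennreal) \<Rightarrow>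
      'a borel_prob \<Rightarrow> 'b borel_prob \<Rightarrow> ('a \<times> 'b) borel_prob set" where
  "optimal_couplings c \<mu> \<nu> = {\<pi>. is_arg_min (plan_cost c) (\<lambda>\<pi>. \<pi> \<in> couplings \<mu> \<nu>) \<pi>}"

definition optimal_plans ::
    "('a::topological_space \<times> 'b::topological_space \<Rightarrow> ennreal) \<Rightarrow> ('a \<times> 'b) borel_prob set" where
  "optimal_plans c = {\<pi>. plan_cost c \<pi> = ot_cost c (pushforward fst \<pi>) (pushforward snd \<pi>)}"

text \<open>
  The cost between laws of random measures: the optimal transport cost whose ground cost is
  itself the optimal transport cost for \<open>c\<close>.
\<close>

abbreviation lifted_cost ::
    "('a::topological_space \<times> 'b::topological_space \<Rightarrow> ennreal) \<Rightarrow>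
      'a borel_prob \<times> 'b borel_prob \<Rightarrow> ennreal" where
  "lifted_cost c \<equiv> (\<lambda>(\<mu>, \<nu>). ot_cost c \<mu> \<nu>)"

definition random_couplings ::
    "'a::topological_space borel_prob borel_prob \<Rightarrow> 'b::topological_space borel_prob borel_prob \<Rightarrow>
      ('a \<times> 'b) borel_prob borel_prob set" where
  "random_couplings M1 M2 =
     {P. pushforward (pushforward fst) P = M1 \<and> pushforward (pushforward snd) P = M2}"

definition marginals ::
    "('a::topological_space \<times> 'b::topological_space) borel_prob \<Rightarrow> 'a borel_prob \<times> 'b borel_prob" where
  "marginals \<pi> = (pushforward fst \<pi>, pushforward snd \<pi>)"

lemma continuous_on_marginals:
  "continuous_on UNIV
     (marginals :: ('a::topological_space \<times> 'b::topological_space) borel_prob \<Rightarrow> _)"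
  unfolding marginals_def
  by (intro continuous_on_Pair continuous_on_pushforward continuous_on_fst continuous_on_snd
      continuous_on_id)

abbreviation random_plan_cost ::
    "('a::topological_space \<Rightarrow> ennreal) \<Rightarrow> 'a borel_prob borel_prob \<Rightarrow> ennreal" where
  "random_plan_cost c P \<equiv> \<integral>\<^sup>+\<pi>. (\<integral>\<^sup>+z. c z \<partial>to_measure \<pi>) \<partial>to_measure P"

end

theory Submission
  imports Defs
begin

text \<open>
  A point \<open>x\<close> of a Polish space is coded by the bits \<open>x \<in> U i\<close>, where \<open>U\<close> enumerates a base; the
  code is measurable with a measurable left inverse.  A probability measure then becomes the array
  of its values on cylinders, the binary digits of this array code the measure itself, and laws of
  random measures are handled in the same way.  Probabilities on the Cantor space are compact for
  convergence on cylinders, and a limit still lives on codes of points because a coupling has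
  prescribed marginals.  A lower semicontinuous cost is the supremum over \<open>n\<close> of its infima over the
  points that share the first \<open>n\<close> bits, so it behaves well under such limits.  This gives the
  measurability of the optimal transport cost.

  Let \<open>R n\<close> be a minimizing sequence for the lifted problem.  Replace each pair of measures by a
  nearly optimal plan between measures with the same first \<open>n\<close> code bits; this choice takes finitely
  many values, so no measurable selection is needed.  The limit of the resulting laws
  of plans is a random coupling of cost at most the lifted cost.  Conversely the cost of a plan
  dominates the optimal cost between its marginals, and if the two have the same finite integral
  then they agree almost everywhere.
\<close>

section \<open>The Borel structure of the narrow topology\<close>

text \<open>The obstacle is the limit of laws of plans. Reading a number off its digits is
  continuous, extracting a digit of a cylinder probability is not, so convergence of codes says
  little about codes of limits. What passes to the limit are integrals of functions determined, up
  to any tolerance, by finitely many bits (\<open>tame\<close>). The properties of a limiting plan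
  are therefore phrased through such functions: consistency of its array, the finite sums giving its
  marginals, the truncated costs. Only afterwards is almost every bit sequence decoded to a plan.
  The codes of the marginals are treated differently: their laws become exactly the prescribed ones
  on each fixed prefix, so that limits of these codes still belong to genuine measures.

  A code of measures has to respect only the Borel structure, which is why the narrow Borel sets are
  identified with those generated by evaluating measures on sets. On the ground spaces the bits come
  from a base, since lower semicontinuity has to be read off finitely many of them.\<close>

fun bump :: "'a::metric_space \<times> rat \<times> nat \<Rightarrow> 'a \<Rightarrow> real" where
  "bump (y, q, n) x = max 0 (of_rat q - real n * dist x y)"

definition max_bump :: "('a::metric_space \<times> rat \<times> nat) list \<Rightarrow> 'a \<Rightarrow> real" where
  "max_bump l x = foldr (\<lambda>i r. max (bump i x) r) l 0"

lemma max_bump_simps [simp]: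
  "max_bump [] x = 0" "max_bump (i # l) x = max (bump i x) (max_bump l x)"
  by (simp_all add: max_bump_def)

lemma max_bump_nonneg: "0 \<le> max_bump l x"
  by (induction l) auto

lemma max_bump_le: "(\<And>i. i \<in> set l \<Longrightarrow> bump i x \<le> r) \<Longrightarrow> 0 \<le> r \<Longrightarrow> max_bump l x \<le> r"
  by (induction l) auto

lemma max_bump_ge: "i \<in> set l \<Longrightarrow> bump i x \<le> max_bump l x"
  by (induction l) auto

lemma continuous_on_max_bump: "continuous_on UNIV (max_bump l)"
proof (induction l)
  case (Cons i l)
  obtain y q n where i: "i = (y, q, n)" by (cases i)
  have "continuous_on UNIV (bump i)"
    unfolding i bump.simps by (intro continuous_intros)
  then show ?case
    using Cons unfolding max_bump_simps by (intro continuous_on_max) (simp_all add: eta_contract_eq)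
qed (simp add: max_bump_def)

lemma bounded_max_bump: "bounded (range (max_bump l))"
proof -
  have "\<exists>B. \<forall>x. max_bump l x \<le> B"
  proof (induction l)
    case (Cons i l)
    then obtain B where B: "\<And>x. max_bump l x \<le> B" by blast
    obtain y q n where i: "i = (y, q, n)" by (cases i)
    have "bump i x \<le> max 0 (of_rat q)" for x
      using mult_nonneg_nonneg[of "real n" "dist x y"] unfolding i bump.simps by (smt (verit) of_nat_0_le_iff zero_le_dist)
    then show ?case
      using B unfolding max_bump_simps by (meson max.mono)
  qed auto
  then obtain B where B: "\<And>x. max_bump l x \<le> B" by blast
  show ?thesis
    using B max_bump_nonneg[of l] by (intro boundedI[of _ B]) auto
qed

text \<open>The centres come from one countable dense set, fixed once for the whole type. The same
  countable family then serves every function to be approximated, which makes the subbasis built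
  from it countable.\<close>

definition bump_index :: "('a::{metric_space, second_countable_topology} \<times> rat \<times> nat) set" where
  "bump_index = (SOME D. countable D \<and> (\<forall>X. open X \<longrightarrow> X \<noteq> {} \<longrightarrow> (\<exists>d\<in>D. d \<in> X))) \<times> UNIV"

lemma bump_index:
  shows "countable (bump_index :: ('a::{metric_space, second_countable_topology} \<times> rat \<times> nat) set)"
    and "open X \<Longrightarrow> (x::'a) \<in> X \<Longrightarrow> \<exists>d\<in>X. (d, q, n) \<in> bump_index"
proof -
  let ?P = "\<lambda>D::'a set. countable D \<and> (\<forall>X. open X \<longrightarrow> X \<noteq> {} \<longrightarrow> (\<exists>d\<in>D. d \<in> X))"
  have "\<exists>D. ?P D"
    by (rule countable_dense_exists)
  then have *: "?P (SOME D. ?P D)"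
    by (rule someI_ex)
  then show "countable (bump_index :: ('a \<times> rat \<times> nat) set)"
    unfolding bump_index_def by (intro countable_SIGMA) auto
  show "open X \<Longrightarrow> (x::'a) \<in> X \<Longrightarrow> \<exists>d\<in>X. (d, q, n) \<in> bump_index"
    using * unfolding bump_index_def by blast
qed

text \<open>A cone of rational height strictly between \<open>t\<close> and \<open>g x\<close> fits
  under \<open>g\<close> once it is steep enough to vanish outside a ball where \<open>g\<close>
  exceeds that height. Its centre is moved from \<open>x\<close> to a dense point so little that the
  value at \<open>x\<close> stays above \<open>t\<close>.\<close>

lemma ex_bump_between:
  fixes g :: "'a::{metric_space, second_countable_topology} \<Rightarrow> real"
  assumes g: "\<And>z. 0 \<le> g z" "\<And>t. open {z. t < g z}" and t: "0 \<le> t" "t < g x"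
  shows "\<exists>i\<in>bump_index. t < bump i x \<and> (\<forall>z. bump i z \<le> g z)"
proof -
  obtain q where q: "t < of_rat q" "of_rat q < g x"
    using of_rat_dense[OF t(2)] by blast
  obtain r where r: "r > 0" "ball x r \<subseteq> {z. of_rat q < g z}"
    using g(2)[of "of_rat q"] q(2) by (force simp: open_contains_ball)
  \<comment> \<open>This slope gives \<open>of_rat q < n * (r / 2)\<close>: the cone vanishes at
    distance \<open>r / 2\<close> from its centre, so with a centre within \<open>r / 2\<close> of
    \<open>x\<close> it is positive only inside \<open>ball x r\<close>. The second bound in
    \<delta> keeps the loss of height at \<open>x\<close> below \<open>of_rat q - t\<close>.\<close>
  obtain n where n: "real n > 2 * of_rat q / r"
    using reals_Archimedean2 by blast
  have n0: "real n > 0"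
    using n q t r by (smt (verit) divide_nonneg_pos)
  define \<delta> where "\<delta> = min (r / 2) ((of_rat q - t) / real n)"
  have "\<delta> > 0"
    using r q n0 by (simp add: \<delta>_def)
  then obtain y where y: "y \<in> ball x \<delta>" "(y, q, n) \<in> bump_index"
    using bump_index(2)[of "ball x \<delta>" x q n] by auto
  have "real n * dist x y < of_rat q - t"
    using y(1) n0 by (simp add: \<delta>_def pos_less_divide_eq mult.commute)
  moreover have "bump (y, q, n) z \<le> g z" for z
  proof (cases "real n * dist z y < of_rat q")
    case True
    have "of_rat q < real n * (r / 2)"
      using n r by (simp add: field_simps)
    with True have "real n * dist z y < real n * (r / 2)" by linarith
    then have "dist z y < r / 2"
      using n0 by simp
    moreover have "dist x y < r / 2"
      using y(1) by (simp add: \<delta>_def)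
    ultimately have "dist x z < r"
      using dist_triangle2[of x z y] by linarith
    then have "of_rat q < g z"
      using r by auto
    moreover have "0 \<le> real n * dist z y" by simp
    ultimately show ?thesis
      using g(1)[of z] unfolding bump.simps by linarith
  qed (simp add: g)
  ultimately show ?thesis
    using y(2) by (intro bexI[of _ "(y, q, n)"]) auto
qed

text \<open>The indexed cones below \<open>g\<close> are countably many and have supremum
  \<open>g\<close>; maxima over initial segments of an enumeration make the convergence
  monotone.\<close>

lemma max_bump_approx:
  fixes g :: "'a::{metric_space, second_countable_topology} \<Rightarrow> real"
  assumes g: "\<And>z. 0 \<le> g z" "\<And>t. open {z. t < g z}"
  obtains F where "\<And>n. F n \<in> lists bump_index" "\<And>n x. max_bump (F n) x \<le> g x"
    "\<And>x. incseq (\<lambda>n. max_bump (F n) x)" "\<And>x. (\<lambda>n. max_bump (F n) x) \<longlonglongrightarrow> g x"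
proof -
  define I where "I = {i \<in> bump_index. \<forall>z. bump i z \<le> g z}"
  have cI: "countable I"
    unfolding I_def using bump_index(1) by (rule countable_subset[rotated]) auto
  have "I \<noteq> {}"
  proof -
    obtain d :: 'a where "(d, 0, 0) \<in> bump_index"
      using bump_index(2)[of UNIV undefined 0 0] by auto
    then have "(d, 0, 0) \<in> I"
      using g(1) by (auto simp: I_def)
    then show ?thesis by blast
  qed
  define e where "e = from_nat_into I"
  have e: "e k \<in> I" for k
    unfolding e_def using \<open>I \<noteq> {}\<close> by (rule from_nat_into)
  define F where "F n = map e [0..<n]" for n
  have inc: "incseq (\<lambda>n. max_bump (F n) x)" for x
    unfolding F_def incseq_def
    by (intro allI impI max_bump_le max_bump_nonneg) (auto intro!: max_bump_ge)
  have le: "max_bump (F n) x \<le> g x" for n x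
    using e g(1) by (intro max_bump_le) (auto simp: F_def I_def)
  show ?thesis
  proof (rule that[of F])
    show "F n \<in> lists bump_index" for n
      using e by (auto simp: F_def I_def)
    show "max_bump (F n) x \<le> g x" for n x
      by (rule le)
    show "incseq (\<lambda>n. max_bump (F n) x)" for x
      by (rule inc)
    show "(\<lambda>n. max_bump (F n) x) \<longlonglongrightarrow> g x" for x
    proof (rule increasing_tendsto)
      show "\<forall>\<^sub>F n in sequentially. max_bump (F n) x \<le> g x"
        using le by simp
      fix t assume t: "t < g x"
      show "\<forall>\<^sub>F n in sequentially. t < max_bump (F n) x"
      proof (cases "0 \<le> t")
        case True
        then obtain i where i: "i \<in> I" "t < bump i x"
          using ex_bump_between[OF g True t] by (auto simp: I_def)
        obtain k where k: "i = e k"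
          using from_nat_into_surj[OF cI i(1)] by (auto simp: e_def)
        have "t < max_bump (F n) x" if "n > k" for n
          using i(2) that by (intro less_le_trans[OF i(2)] max_bump_ge) (auto simp: F_def k)
        then show ?thesis
          by (intro eventually_sequentiallyI[of "Suc k"]) auto
      next
        case False
        then show ?thesis
          using max_bump_nonneg[of _ x] by (intro always_eventually) (meson less_le_trans not_le)
      qed
    qed
  qed
qed

text \<open>The lists are chosen before the measure. One sequence works for all \<mu>, so the
  integral of \<open>g\<close> is, as a function of \<mu>, a pointwise limit of integrals of bounded
  continuous functions.\<close>

lemma integral_max_bump_LIMSEQ:
  fixes g :: "'a::{metric_space, second_countable_topology} \<Rightarrow> real"
  assumes g: "\<And>z. 0 \<le> g z" "\<And>t. open {z. t < g z}" and b: "\<And>z. g z \<le> b"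
  obtains F where "\<And>n. F n \<in> lists bump_index" "\<And>n x. max_bump (F n) x \<le> g x"
    "\<And>\<mu>. (\<lambda>n. \<integral>x. max_bump (F n) x \<partial>to_measure \<mu>) \<longlonglongrightarrow> (\<integral>x. g x \<partial>to_measure \<mu>)"
proof -
  obtain F where F: "\<And>n. F n \<in> lists bump_index" "\<And>n x. max_bump (F n) x \<le> g x"
    "\<And>x. (\<lambda>n. max_bump (F n) x) \<longlonglongrightarrow> g x"
    using max_bump_approx[OF g] by metis
  have gm: "g \<in> borel_measurable borel"
    using g(2) by (intro borel_measurableI_greater) auto
  show ?thesis
  proof (rule that[of F])
    fix \<mu> :: "'a borel_prob"
    interpret prob_space "to_measure \<mu>" by simp
    have [measurable]: "max_bump l \<in> borel_measurable borel" for l :: "('a \<times> rat \<times> nat) list"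
      by (rule borel_measurable_continuous_onI[OF continuous_on_max_bump])
    show "(\<lambda>n. \<integral>x. max_bump (F n) x \<partial>to_measure \<mu>) \<longlonglongrightarrow> (\<integral>x. g x \<partial>to_measure \<mu>)"
    proof (rule integral_dominated_convergence[where w = "\<lambda>_. b"])
      show "AE x in to_measure \<mu>. norm (max_bump (F n) x) \<le> b" for n
        using F(2) b max_bump_nonneg[of "F n"] by (auto intro!: AE_I2 intro: order_trans)
    qed (use gm F(3) in \<open>auto cong: measurable_cong_sets\<close>)
  qed (use F in auto)
qed

section \<open>A countable subbasis, and the narrow Borel sets as those of evaluation maps\<close>

definition narrow_subbasis :: "'a::topological_space borel_prob set set" where
  "narrow_subbasis = {{\<mu>. (\<integral>x. f x \<partial>to_measure \<mu>) \<in> U} | (f :: 'a \<Rightarrow> real) U.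
        continuous_on UNIV f \<and> bounded (range f) \<and> open U}"

lemma open_borel_prob_eq: "open = generate_topology narrow_subbasis"
  by (simp add: open_borel_prob_def narrow_subbasis_def)

lemma integrable_bounded_continuous:
  fixes f :: "'a::topological_space \<Rightarrow> real"
  assumes "continuous_on UNIV f" "bounded (range f)"
  shows "integrable (to_measure \<mu>) f"
proof -
  interpret prob_space "to_measure \<mu>" by simp
  obtain B where "\<And>x. norm (f x) \<le> B"
    using assms(2) by (auto simp: bounded_iff)
  then show ?thesis
    using borel_measurable_continuous_onI[OF assms(1)]
    by (intro integrable_const_bound[of _ B]) (auto cong: measurable_cong_sets)
qed

definition countable_subbasis :: "'a::{metric_space, second_countable_topology} borel_prob set set" where
  "countable_subbasis =
    (\<lambda>(l, q). {\<mu>. of_rat q < (\<integral>x. max_bump l x \<partial>to_measure \<mu>)}) ` (lists bump_index \<times> UNIV)"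

lemma countable_subbasis: "countable countable_subbasis"
  unfolding countable_subbasis_def using bump_index(1) by auto

lemma generate_greater_integral:
  fixes g :: "'a::{metric_space, second_countable_topology} \<Rightarrow> real"
  assumes c: "continuous_on UNIV g" "bounded (range g)"
  shows "generate_topology countable_subbasis {\<mu>. t < (\<integral>x. g x \<partial>to_measure \<mu>)}"
proof -
  obtain B where B: "\<And>x. \<bar>g x\<bar> \<le> B"
    using c(2) by (auto simp: bounded_iff)
  \<comment> \<open>Adding \<open>B\<close> makes the function nonnegative, as approximation by
    cones requires, and shifts every integral by exactly \<open>B\<close> because the mass is
    one.\<close>
  define h where "h x = g x + B" for x
  have h: "0 \<le> h z" "h z \<le> 2 * B" for z
    using B[of z] by (auto simp: h_def)
  have ho: "open {z. s < h z}" for s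
    unfolding h_def using c(1) by (intro open_Collect_less continuous_intros)
  obtain F where F: "\<And>n. F n \<in> lists bump_index" "\<And>n x. max_bump (F n) x \<le> h x"
    "\<And>\<mu>. (\<lambda>n. \<integral>x. max_bump (F n) x \<partial>to_measure \<mu>) \<longlonglongrightarrow> (\<integral>x. h x \<partial>to_measure \<mu>)"
    using integral_max_bump_LIMSEQ[OF h(1) ho h(2)] by metis
  define K where "K = {{\<mu>. of_rat q < (\<integral>x. max_bump (F n) x \<partial>to_measure \<mu>)} | n q. t + B \<le> of_rat q}"
  have inth: "(\<integral>x. h x \<partial>to_measure \<mu>) = (\<integral>x. g x \<partial>to_measure \<mu>) + B" for \<mu> :: "'a borel_prob"
    using integrable_bounded_continuous[OF c] prob_space.prob_space[OF prob_space_to_measure[of \<mu>]]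
      prob_space.finite_measure[OF prob_space_to_measure[of \<mu>]]
    by (simp add: h_def finite_measure.integrable_const)
  have "{\<mu>. t < (\<integral>x. g x \<partial>to_measure \<mu>)} = \<Union>K"
  proof (intro equalityI subsetI)
    fix \<mu> assume "\<mu> \<in> {\<mu>. t < (\<integral>x. g x \<partial>to_measure \<mu>)}"
    then have "t + B < (\<integral>x. h x \<partial>to_measure \<mu>)"
      by (simp add: inth)
    then obtain q where q: "t + B < of_rat q" "of_rat q < (\<integral>x. h x \<partial>to_measure \<mu>)"
      using of_rat_dense by blast
    have "\<forall>\<^sub>F n in sequentially. of_rat q < (\<integral>x. max_bump (F n) x \<partial>to_measure \<mu>)"
      using F(3) q(2) by (rule order_tendstoD)
    then obtain n where "of_rat q < (\<integral>x. max_bump (F n) x \<partial>to_measure \<mu>)"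
      by (auto simp: eventually_sequentially)
    then show "\<mu> \<in> \<Union>K"
      using q(1) unfolding K_def by (intro UnionI CollectI exI conjI) (auto intro: less_imp_le)
  next
    fix \<mu> assume "\<mu> \<in> \<Union>K"
    then obtain q n where q: "t + B \<le> of_rat q" "of_rat q < (\<integral>x. max_bump (F n) x \<partial>to_measure \<mu>)"
      by (auto simp: K_def)
    have "(\<integral>x. max_bump (F n) x \<partial>to_measure \<mu>) \<le> (\<integral>x. h x \<partial>to_measure \<mu>)"
    proof (rule integral_mono)
      show "integrable (to_measure \<mu>) h"
        using c B h unfolding h_def
        by (intro integrable_bounded_continuous continuous_intros boundedI[of _ "2 * B"]) (auto simp: h_def)
    qed (use F(2) in \<open>auto intro: integrable_bounded_continuous continuous_on_max_bump bounded_max_bump\<close>)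
    then show "\<mu> \<in> {\<mu>. t < (\<integral>x. g x \<partial>to_measure \<mu>)}"
      using q by (simp add: inth)
  qed
  moreover have "generate_topology countable_subbasis (\<Union>K)"
    using F(1) by (intro generate_topology.UN generate_topology.Basis) (force simp: K_def countable_subbasis_def)
  ultimately show ?thesis by simp
qed

lemma open_borel_prob_countable_subbasis:
  "(open :: 'a::{metric_space, second_countable_topology} borel_prob set \<Rightarrow> bool) =
     generate_topology countable_subbasis"
proof (intro ext iffI)
  fix S :: "'a borel_prob set"
  assume "open S"
  then have "generate_topology narrow_subbasis S"
    by (simp add: open_borel_prob_eq)
  then show "generate_topology countable_subbasis S"
  proof induction
    case (Basis S)
    then obtain f :: "'a \<Rightarrow> real" and U where S: "S = {\<mu>. (\<integral>x. f x \<partial>to_measure \<mu>) \<in> U}"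
      and f: "continuous_on UNIV f" "bounded (range f)" and U: "open U"
      by (auto simp: narrow_subbasis_def)
    \<comment> \<open>The subbasis offers only lower bounds on integrals; an upper bound for
      \<open>f\<close> is a lower bound for \<open>- f\<close>.\<close>
    define K where "K = {{\<mu>. a < (\<integral>x. f x \<partial>to_measure \<mu>)} \<inter> {\<mu>. - b < (\<integral>x. - f x \<partial>to_measure \<mu>)} |
      a b. {a<..<b} \<subseteq> U}"
    have "S = \<Union>K"
    proof (intro equalityI subsetI)
      fix \<mu> assume "\<mu> \<in> S"
      then obtain e where "e > 0" "ball (\<integral>x. f x \<partial>to_measure \<mu>) e \<subseteq> U"
        using U by (auto simp: S open_contains_ball)
      then show "\<mu> \<in> \<Union>K"
        unfolding K_def ball_eq_greaterThanLessThan
        by (intro UnionI CollectI exI conjI) (auto intro: refl)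
    next
      fix \<mu> assume "\<mu> \<in> \<Union>K"
      then show "\<mu> \<in> S" by (auto simp: K_def S)
    qed
    moreover have "generate_topology countable_subbasis (\<Union>K)"
      using f by (intro generate_topology.UN)
        (auto simp: K_def bounded_uminus simp del: integral_minus Bochner_Integration.integral_minus
          intro!: generate_topology.Int generate_greater_integral continuous_intros)
    ultimately show ?case by simp
  qed (auto intro: generate_topology.intros)
next
  fix S :: "'a borel_prob set"
  assume "generate_topology countable_subbasis S"
  then show "open S"
  proof induction
    case (Basis S)
    then obtain l q where "S = {\<mu>. (\<integral>x. max_bump l x \<partial>to_measure \<mu>) \<in> {of_rat q<..}}"
      by (auto simp: countable_subbasis_def)
    then have "S \<in> narrow_subbasis"
      unfolding narrow_subbasis_def using continuous_on_max_bump bounded_max_bump open_greaterThan by blast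
    then show ?case
      unfolding open_borel_prob_eq by (rule generate_topology.Basis)
  qed auto
qed

text \<open>Second countability makes rectangles generate the Borel sets of a product of spaces of
  measures. Product couplings and pair codes are used there too, for laws of random
  measures.\<close>

instance borel_prob :: (polish_space) second_countable_topology
proof
  show "\<exists>B::'a borel_prob set set. countable B \<and> open = generate_topology B"
    using countable_subbasis open_borel_prob_countable_subbasis by blast
qed

lemma borel_eq_countable_subbasis:
  "(borel :: 'a::polish_space borel_prob measure) = sigma UNIV countable_subbasis"
  using open_borel_prob_countable_subbasis by (rule second_countable_borel_measurable)

lemma continuous_on_integral_borel_prob:
  fixes f :: "'a::topological_space \<Rightarrow> real"
  assumes "continuous_on UNIV f" "bounded (range f)"
  shows "continuous_on UNIV (\<lambda>\<mu>. \<integral>x. f x \<partial>to_measure \<mu>)"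
  unfolding continuous_on_open_vimage[OF open_UNIV]
  using assms by (auto simp: open_borel_prob_eq narrow_subbasis_def vimage_def intro!: generate_topology.Basis)

text \<open>The indicator of an open set is a limit of finite maxima of cones, so its integral is a
  limit of continuous functions of the measure; open sets form a generator stable under
  intersection.\<close>

lemma measurable_to_measure [measurable]:
  "(to_measure :: 'a::polish_space borel_prob \<Rightarrow> _) \<in> borel \<rightarrow>\<^sub>M prob_algebra borel"
proof (rule measurable_prob_algebra_generated)
  show "sets (borel :: 'a measure) = sigma_sets UNIV {S. open S}"
    by (simp add: borel_def)
  show "Int_stable {S::'a set. open S}"
    by (auto simp: Int_stable_def)
  fix U :: "'a set" assume "U \<in> {S. open S}"
  then have U: "open U" by simp
  have o: "open {z. t < (indicator U z :: real)}" for t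
  proof (cases "t < 0")
    case False
    then have "{z. t < (indicator U z :: real)} = (if t < 1 then U else {})"
      by (auto simp: indicator_def split: if_splits)
    then show ?thesis using U by simp
  next
    case True
    then have "{z. t < (indicator U z :: real)} = UNIV"
      by (auto simp: indicator_def split: if_splits)
    then show ?thesis by simp
  qed
  obtain F where F: "\<And>n. F n \<in> lists bump_index"
    "\<And>\<mu>. (\<lambda>n. \<integral>x. max_bump (F n) x \<partial>to_measure \<mu>) \<longlonglongrightarrow> (\<integral>x. indicator U x \<partial>to_measure \<mu>)"
    using integral_max_bump_LIMSEQ[of "indicator U :: 'a \<Rightarrow> real" 1]
    by (metis o indicator_pos_le indicator_le_1)
  have "(\<lambda>\<mu>. \<integral>x. (indicator U x :: real) \<partial>to_measure \<mu>) \<in> borel_measurable borel"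
    by (rule borel_measurable_LIMSEQ_metric[OF borel_measurable_continuous_onI F(2)])
      (intro continuous_on_integral_borel_prob continuous_on_max_bump bounded_max_bump)
  then show "(\<lambda>\<mu>. emeasure (to_measure \<mu>) U) \<in> borel_measurable borel"
    using U by (simp add: finite_measure.emeasure_eq_measure[OF prob_space.finite_measure[OF prob_space_to_measure]])
qed auto

text \<open>This is the converse of \<open>measurable_to_measure\<close>: the integrals that define
  the countable subbasis are measurable for the sigma-algebra of evaluations on sets. Maps into a
  space of measures can thus be checked as kernels.\<close>

lemma borel_measurable_borel_probI:
  fixes f :: "'b \<Rightarrow> 'a::polish_space borel_prob"
  assumes "(\<lambda>x. to_measure (f x)) \<in> M \<rightarrow>\<^sub>M prob_algebra borel"
  shows "f \<in> borel_measurable M"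
proof -
  have "f \<in> M \<rightarrow>\<^sub>M sigma UNIV countable_subbasis"
  proof (rule measurable_sigma_sets[where \<Omega> = UNIV and A = countable_subbasis])
    fix S :: "'a borel_prob set" assume "S \<in> countable_subbasis"
    then obtain l q where S: "S = {\<mu>. of_rat q < (\<integral>x. max_bump l x \<partial>to_measure \<mu>)}"
      by (auto simp: countable_subbasis_def)
    have m: "(\<lambda>N. \<integral>x. max_bump l x \<partial>N) \<in> borel_measurable (subprob_algebra borel)"
      using bounded_max_bump[of l] borel_measurable_continuous_onI[OF continuous_on_max_bump[of l]]
      by (intro integral_measurable_subprob_algebra) (auto simp: bounded_iff)
    have "(\<lambda>x. \<integral>z. max_bump l z \<partial>to_measure (f x)) \<in> borel_measurable M"
      by (rule measurable_compose[OF measurable_prob_algebraD[OF assms] m])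
    then have "{x \<in> space M. of_rat q < (\<integral>z. max_bump l z \<partial>to_measure (f x))} \<in> sets M"
      by measurable
    then show "f -` S \<inter> space M \<in> sets M"
      by (simp add: S vimage_def Int_def conj_commute)
  qed auto
  then show ?thesis
    by (simp add: borel_eq_countable_subbasis)
qed

section \<open>Measures on the Cantor space\<close>

definition cantor :: "(nat \<Rightarrow> bool) measure" where
  "cantor = (\<Pi>\<^sub>M i\<in>UNIV. count_space UNIV)"

definition cyl :: "bool list \<Rightarrow> (nat \<Rightarrow> bool) set" where
  "cyl u = {b. \<forall>i<length u. b i = u ! i}"

definition lists_of :: "nat \<Rightarrow> bool list set" where
  "lists_of n = {u. length u = n}"

lemma space_cantor [simp]: "space cantor = UNIV"
  by (simp add: cantor_def space_PiM)

lemma measurable_cantor_bit [measurable]: "(\<lambda>b. b i) \<in> cantor \<rightarrow>\<^sub>M count_space UNIV"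
  unfolding cantor_def by (rule measurable_component_singleton) simp

lemma measurable_into_cantor:
  assumes "\<And>i. (\<lambda>x. f x i) \<in> M \<rightarrow>\<^sub>M count_space UNIV"
  shows "f \<in> M \<rightarrow>\<^sub>M cantor"
  unfolding cantor_def using assms by (intro measurable_PiM_single') auto

lemma measurable_reindex_cantor [measurable]: "(\<lambda>b. b \<circ> \<gamma>) \<in> cantor \<rightarrow>\<^sub>M cantor"
  by (rule measurable_into_cantor) (simp add: comp_def)

lemma sets_cyl [measurable]: "cyl u \<in> sets cantor"
proof -
  have "{b \<in> space cantor. \<forall>i<length u. b i = u ! i} \<in> sets cantor"
    by measurable
  then show ?thesis by (simp add: cyl_def)
qed

lemma finite_lists_of [simp]: "finite (lists_of n)"
  using finite_lists_length_eq[of "UNIV::bool set" n] by (simp add: lists_of_def)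

lemma map_upt_in_lists_of [simp]: "map b [0..<n] \<in> lists_of n"
  by (simp add: lists_of_def)

lemma mem_cyl_iff: "length u = n \<Longrightarrow> b \<in> cyl u \<longleftrightarrow> map b [0..<n] = u"
  by (auto simp: cyl_def list_eq_iff_nth_eq)

lemma cyl_Int: "cyl u \<inter> cyl v \<in> insert {} (range cyl)"
proof -
  have *: "cyl u \<inter> cyl v \<in> insert {} (range cyl)" if "length u \<le> length v" for u v
  proof (cases "\<forall>i<length u. u ! i = v ! i")
    case True
    then have "cyl u \<inter> cyl v = cyl v"
      using that by (auto simp: cyl_def)
    then show ?thesis by simp
  next
    case False
    then have "cyl u \<inter> cyl v = {}"
      using that by (force simp: cyl_def)
    then show ?thesis by simp
  qed
  show ?thesis
    using *[of u v] *[of v u] by (cases "length u \<le> length v") (auto simp: Int_commute)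
qed

lemma Int_stable_cyl: "Int_stable (insert {} (range cyl))"
  using cyl_Int by (force simp: Int_stable_def)

text \<open>A condition on bit \<open>i\<close> is a finite union of cylinders of length
  \<open>Suc i\<close>.\<close>

lemma sets_cantor: "sets cantor = sigma_sets UNIV (insert {} (range cyl))" (is "_ = sigma_sets _ ?G")
proof
  show "sigma_sets UNIV ?G \<subseteq> sets cantor"
    using sets.sigma_sets_subset[of ?G cantor] sets_cyl by (auto simp: image_subset_iff)
  have "{f. f i \<in> A} \<in> sigma_sets UNIV ?G" for i :: nat and A
  proof -
    have "{f. f i \<in> A} = (\<Union>u\<in>{u \<in> lists_of (Suc i). u ! i \<in> A}. cyl u)"
    proof (intro equalityI subsetI)
      fix f assume "f \<in> {f. f i \<in> A}"
      then show "f \<in> (\<Union>u\<in>{u \<in> lists_of (Suc i). u ! i \<in> A}. cyl u)"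
        by (intro UN_I[of "map f [0..<Suc i]"]) (auto simp: lists_of_def cyl_def nth_append simp del: upt_Suc)
    qed (auto simp: lists_of_def cyl_def)
    also have "\<dots> \<in> sigma_sets UNIV ?G"
      by (intro sigma_sets_UNION) (auto simp: countable_finite)
    finally show ?thesis .
  qed
  then show "sets cantor \<subseteq> sigma_sets UNIV ?G"
    unfolding cantor_def sets_PiM_single
    by (simp add: PiE_UNIV_domain) (rule sigma_sets_mono, auto)
qed

lemma cantor_measure_eqI:
  assumes M: "prob_space M" "sets M = sets cantor" and N: "prob_space N" "sets N = sets cantor"
    and eq: "\<And>u. measure M (cyl u) = measure N (cyl u)"
  shows "M = N"
proof (rule measure_eqI_generator_eq[OF Int_stable_cyl, where \<Omega> = UNIV and A = "\<lambda>_. UNIV"])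
  interpret M: prob_space M by fact
  interpret N: prob_space N by fact
  show "emeasure M X = emeasure N X" if "X \<in> insert {} (range cyl)" for X
    using that eq by (auto simp: M.emeasure_eq_measure N.emeasure_eq_measure)
  have "cyl [] = UNIV" by (simp add: cyl_def)
  then show "range (\<lambda>_. UNIV) \<subseteq> insert {} (range cyl)" by blast
qed (use assms sets_cantor in \<open>auto simp: prob_space.emeasure_le_1 finite_measure.emeasure_finite prob_space.finite_measure\<close>)

text \<open>By compactness this is continuity for the product topology.\<close>

definition tame :: "((nat \<Rightarrow> bool) \<Rightarrow> real) \<Rightarrow> bool" where
  "tame f \<longleftrightarrow> (\<forall>\<epsilon>>0. \<exists>N. \<forall>b b'. (\<forall>i<N. b i = b' i) \<longrightarrow> \<bar>f b - f b'\<bar> \<le> \<epsilon>)"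

lemma tameD: "tame f \<Longrightarrow> \<epsilon> > 0 \<Longrightarrow> \<exists>N. \<forall>b b'. (\<forall>i<N. b i = b' i) \<longrightarrow> \<bar>f b - f b'\<bar> \<le> \<epsilon>"
  by (simp add: tame_def)

lemma tame_const: "tame (\<lambda>_. r)"
  by (simp add: tame_def)

lemma tame_add:
  assumes "tame f" "tame g"
  shows "tame (\<lambda>b. f b + g b)"
  unfolding tame_def
proof (intro allI impI)
  fix \<epsilon> :: real assume "\<epsilon> > 0"
  then obtain N1 N2 where N: "\<And>b b'. \<forall>i<N1. b i = b' i \<Longrightarrow> \<bar>f b - f b'\<bar> \<le> \<epsilon> / 2"
    "\<And>b b'. \<forall>i<N2. b i = b' i \<Longrightarrow> \<bar>g b - g b'\<bar> \<le> \<epsilon> / 2"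
    using tameD[OF assms(1), of "\<epsilon> / 2"] tameD[OF assms(2), of "\<epsilon> / 2"] half_gt_zero by metis
  have "\<bar>(f b + g b) - (f b' + g b')\<bar> \<le> \<epsilon>" if "\<forall>i<max N1 N2. b i = b' i" for b b'
    using N(1)[of b b'] N(2)[of b b'] that by (auto simp: abs_if split: if_splits)
  then show "\<exists>N. \<forall>b b'. (\<forall>i<N. b i = b' i) \<longrightarrow> \<bar>(f b + g b) - (f b' + g b')\<bar> \<le> \<epsilon>"
    by blast
qed

lemma tame_uminus: "tame f \<Longrightarrow> tame (\<lambda>b. - f b)"
  unfolding tame_def by (metis abs_minus_commute minus_diff_minus abs_minus_cancel)

lemma tame_cmult:
  assumes "tame f"
  shows "tame (\<lambda>b. a * f b)"
  unfolding tame_def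
proof (intro allI impI)
  fix \<epsilon> :: real assume "\<epsilon> > 0"
  then have "\<epsilon> / (\<bar>a\<bar> + 1) > 0" by simp
  then obtain N where N: "\<And>b b'. \<forall>i<N. b i = b' i \<Longrightarrow> \<bar>f b - f b'\<bar> \<le> \<epsilon> / (\<bar>a\<bar> + 1)"
    using tameD[OF assms] by metis
  have "\<bar>a * f b - a * f b'\<bar> \<le> \<epsilon>" if "\<forall>i<N. b i = b' i" for b b'
  proof -
    have "\<bar>a * f b - a * f b'\<bar> = \<bar>a\<bar> * \<bar>f b - f b'\<bar>"
      by (simp add: abs_mult flip: right_diff_distrib)
    also have "\<dots> \<le> (\<bar>a\<bar> + 1) * \<bar>f b - f b'\<bar>"
      by (simp add: mult_right_mono)
    also have "\<dots> \<le> \<epsilon>"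
      using N[OF that] by (simp add: pos_le_divide_eq mult.commute)
    finally show ?thesis .
  qed
  then show "\<exists>N. \<forall>b b'. (\<forall>i<N. b i = b' i) \<longrightarrow> \<bar>a * f b - a * f b'\<bar> \<le> \<epsilon>" by blast
qed

lemma tame_diff: "tame f \<Longrightarrow> tame g \<Longrightarrow> tame (\<lambda>b. f b - g b)"
  using tame_add[OF _ tame_uminus, of f g] by simp

lemma tame_abs:
  assumes "tame f"
  shows "tame (\<lambda>b. \<bar>f b\<bar>)"
  unfolding tame_def
proof (intro allI impI)
  fix \<epsilon> :: real assume "\<epsilon> > 0"
  then obtain N where "\<And>b b'. \<forall>i<N. b i = b' i \<Longrightarrow> \<bar>f b - f b'\<bar> \<le> \<epsilon>"
    using tameD[OF assms] by metis
  then show "\<exists>N. \<forall>b b'. (\<forall>i<N. b i = b' i) \<longrightarrow> \<bar>\<bar>f b\<bar> - \<bar>f b'\<bar>\<bar> \<le> \<epsilon>"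
    using abs_triangle_ineq3 by (intro exI[of _ N] allI impI) (rule order_trans)
qed

lemma tame_sum: "(\<And>i. i \<in> I \<Longrightarrow> tame (f i)) \<Longrightarrow> tame (\<lambda>b. \<Sum>i\<in>I. f i b)"
  by (induction I rule: infinite_finite_induct) (auto intro: tame_const tame_add)

lemma tame_reindex:
  assumes "tame f"
  shows "tame (\<lambda>b. f (b \<circ> \<gamma>))"
  unfolding tame_def
proof (intro allI impI)
  fix \<epsilon> :: real assume "\<epsilon> > 0"
  then obtain N where N: "\<And>b b'. \<forall>i<N. b i = b' i \<Longrightarrow> \<bar>f b - f b'\<bar> \<le> \<epsilon>"
    using tameD[OF assms] by metis
  obtain K where "\<forall>n\<in>\<gamma> ` {..<N}. n < K"
    using finite_nat_set_iff_bounded[of "\<gamma> ` {..<N}"] by auto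
  then show "\<exists>K. \<forall>b b'. (\<forall>i<K. b i = b' i) \<longrightarrow> \<bar>f (b \<circ> \<gamma>) - f (b' \<circ> \<gamma>)\<bar> \<le> \<epsilon>"
    using N by (intro exI[of _ K]) auto
qed

text \<open>Padding with \<open>False\<close> picks a sample point in each cylinder.\<close>

definition extend_bits :: "bool list \<Rightarrow> nat \<Rightarrow> bool" where
  "extend_bits u i \<longleftrightarrow> i < length u \<and> u ! i"

lemma extend_bits_map: "i < n \<Longrightarrow> extend_bits (map b [0..<n]) i = b i"
  by (simp add: extend_bits_def)

text \<open>Exactly one cylinder of level \<open>n\<close> contains \<open>b\<close>. Read from
  right to left, this exhibits a function of the first \<open>n\<close> bits as a simple
  function.\<close>

lemma sum_indicator_cyl:
  fixes f :: "bool list \<Rightarrow> 'r::semiring_1"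
  shows "(\<Sum>u\<in>lists_of n. f u * indicator (cyl u) b) = f (map b [0..<n])"
proof -
  have "(\<Sum>u\<in>lists_of n. f u * indicator (cyl u) b) = (\<Sum>u\<in>lists_of n. if u = map b [0..<n] then f u else 0)"
    by (intro sum.cong) (auto simp: lists_of_def mem_cyl_iff indicator_def)
  then show ?thesis by simp
qed

lemma integral_finite_bits:
  assumes "prob_space Q" "sets Q = sets cantor"
  shows "(\<integral>b. f (map b [0..<n]) \<partial>Q) = (\<Sum>u\<in>lists_of n. f u * measure Q (cyl u) :: real)"
    and "integrable Q (\<lambda>b. f (map b [0..<n]) :: real)"
proof -
  interpret prob_space Q by fact
  have [measurable]: "cyl u \<in> sets Q" for u by (simp add: assms)
  have *: "(\<lambda>b. f (map b [0..<n])) = (\<lambda>b. \<Sum>u\<in>lists_of n. f u * indicator (cyl u) b)"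
    by (simp add: sum_indicator_cyl)
  show "(\<integral>b. f (map b [0..<n]) \<partial>Q) = (\<Sum>u\<in>lists_of n. f u * measure Q (cyl u))"
    unfolding * by (subst Bochner_Integration.integral_sum) (auto simp: emeasure_eq_measure)
  show "integrable Q (\<lambda>b. f (map b [0..<n]))"
    unfolding * by (intro Bochner_Integration.integrable_sum integrable_mult_right integrable_real_indicator)
      (auto simp: emeasure_eq_measure)
qed

lemma tame_measurable:
  assumes "tame f"
  shows "f \<in> borel_measurable cantor"
proof (rule borel_measurable_LIMSEQ_metric)
  fix n
  have "(\<lambda>b. \<Sum>u\<in>lists_of n. f (extend_bits u) * indicator (cyl u) b) \<in> borel_measurable cantor"
    by measurable
  then show "(\<lambda>b. f (extend_bits (map b [0..<n]))) \<in> borel_measurable cantor"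
    by (simp add: sum_indicator_cyl)
next
  fix b
  show "(\<lambda>n. f (extend_bits (map b [0..<n]))) \<longlonglongrightarrow> f b"
  proof (rule LIMSEQ_I)
    fix r :: real assume "r > 0"
    then obtain N where N: "\<And>b b'. \<forall>i<N. b i = b' i \<Longrightarrow> \<bar>f b - f b'\<bar> \<le> r / 2"
      using tameD[OF assms, of "r / 2"] half_gt_zero by metis
    have "norm (f (extend_bits (map b [0..<n])) - f b) < r" if "n \<ge> N" for n
      using N[of "extend_bits (map b [0..<n])" b] that \<open>r > 0\<close> by (auto simp: extend_bits_map)
    then show "\<exists>no. \<forall>n\<ge>no. norm (f (extend_bits (map b [0..<n])) - f b) < r" by blast
  qed
qed

lemma tame_bounded:
  assumes "tame f"
  obtains B where "\<And>b. \<bar>f b\<bar> \<le> B"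
proof -
  obtain N where N: "\<And>b b'. \<forall>i<N. b i = b' i \<Longrightarrow> \<bar>f b - f b'\<bar> \<le> 1"
    using tameD[OF assms, of 1] by auto
  have "\<bar>f b\<bar> \<le> (\<Sum>u\<in>lists_of N. \<bar>f (extend_bits u)\<bar>) + 1" for b
  proof -
    have "\<bar>f (extend_bits (map b [0..<N]))\<bar> \<le> (\<Sum>u\<in>lists_of N. \<bar>f (extend_bits u)\<bar>)"
      by (rule member_le_sum) auto
    then show ?thesis
      using N[of b "extend_bits (map b [0..<N])"] by (auto simp: extend_bits_map)
  qed
  then show ?thesis by (rule that)
qed

lemma tame_integrable:
  assumes "tame f" "prob_space Q" "sets Q = sets cantor"
  shows "integrable Q f"
proof -
  interpret prob_space Q by fact
  obtain B where "\<And>b. \<bar>f b\<bar> \<le> B" using tame_bounded[OF assms(1)] by blast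
  then show ?thesis
    using tame_measurable[OF assms(1)] assms(3)
    by (intro integrable_const_bound[of _ B]) (auto cong: measurable_cong_sets)
qed

text \<open>With an error that is the same for all probability measures, \<open>f\<close> is
  replaced by a function of finitely many bits, whose integral is a finite linear combination of
  cylinder probabilities. Three errors of \<open>r / 4\<close> stay strictly below
  \<open>r\<close>.\<close>

lemma tame_integral_LIMSEQ:
  assumes Q: "\<And>n. prob_space (Q n)" "\<And>n. sets (Q n) = sets cantor"
    and L: "prob_space L" "sets L = sets cantor"
    and lim: "\<And>u. (\<lambda>n. measure (Q n) (cyl u)) \<longlonglongrightarrow> measure L (cyl u)"
    and f: "tame f"
  shows "(\<lambda>n. \<integral>b. f b \<partial>Q n) \<longlonglongrightarrow> (\<integral>b. f b \<partial>L)"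
proof (rule LIMSEQ_I)
  fix r :: real assume r: "r > 0"
  then obtain N where N: "\<And>b b'. \<forall>i<N. b i = b' i \<Longrightarrow> \<bar>f b - f b'\<bar> \<le> r / 4"
    using tameD[OF f, of "r / 4"] by (metis divide_pos_pos zero_less_numeral)
  define g where "g b = f (extend_bits (map b [0..<N]))" for b
  have fg: "\<bar>f b - g b\<bar> \<le> r / 4" for b
    using N[of b "extend_bits (map b [0..<N])"] by (auto simp: g_def extend_bits_map)
  have close: "\<bar>(\<integral>b. f b \<partial>P) - (\<integral>b. g b \<partial>P)\<bar> \<le> r / 4" if P: "prob_space P" "sets P = sets cantor" for P
  proof -
    interpret prob_space P by fact
    have i: "integrable P f" "integrable P g"
      unfolding g_def using tame_integrable[OF f P] integral_finite_bits(2)[OF P] by auto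
    have "(\<integral>b. f b \<partial>P) - (\<integral>b. g b \<partial>P) = (\<integral>b. f b - g b \<partial>P)"
      using i by simp
    moreover have "\<bar>\<integral>b. f b - g b \<partial>P\<bar> \<le> (\<integral>b. \<bar>f b - g b\<bar> \<partial>P)"
      by (rule integral_abs_bound)
    moreover have "(\<integral>b. \<bar>f b - g b\<bar> \<partial>P) \<le> r / 4"
      using i fg by (intro integral_le_const) auto
    ultimately show ?thesis by linarith
  qed
  have "(\<lambda>n. \<integral>b. g b \<partial>Q n) \<longlonglongrightarrow> (\<integral>b. g b \<partial>L)"
    unfolding g_def integral_finite_bits(1)[OF Q, where f = "\<lambda>u. f (extend_bits u)"]
      integral_finite_bits(1)[OF L, where f = "\<lambda>u. f (extend_bits u)"]
    using lim by (intro tendsto_intros)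
  then obtain n0 where n0: "\<And>n. n \<ge> n0 \<Longrightarrow> \<bar>(\<integral>b. g b \<partial>Q n) - (\<integral>b. g b \<partial>L)\<bar> < r / 4"
    using LIMSEQ_D[of _ _ "r / 4"] r by (metis divide_pos_pos real_norm_def zero_less_numeral)
  have "norm ((\<integral>b. f b \<partial>Q n) - (\<integral>b. f b \<partial>L)) < r" if "n \<ge> n0" for n
    using close[OF Q, of n] close[OF L] n0[OF that] r by (simp add: abs_if split: if_splits)
  then show "\<exists>no. \<forall>n\<ge>no. norm ((\<integral>b. f b \<partial>Q n) - (\<integral>b. f b \<partial>L)) < r" by blast
qed

section \<open>Measures with prescribed cylinder probabilities\<close>

definition cyl_array :: "(bool list \<Rightarrow> real) \<Rightarrow> bool" where
  "cyl_array z \<longleftrightarrow> z [] = 1 \<and> (\<forall>u. 0 \<le> z u) \<and> (\<forall>u. z u = z (u @ [False]) + z (u @ [True]))"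

lemma cyl_arrayD:
  assumes "cyl_array z"
  shows "z [] = 1" "0 \<le> z u" "z u = z (u @ [False]) + z (u @ [True])"
  using assms unfolding cyl_array_def by blast+

text \<open>To realise an array by a measure, refine \<open>[0, 1)\<close> into nested intervals whose
  lengths are the prescribed values, and read off the itinerary of a uniform random point.  The
  second component of \<open>itinerary\<close> is the left end point of the current interval.\<close>

primrec itinerary :: "(bool list \<Rightarrow> real) \<Rightarrow> nat \<Rightarrow> real \<Rightarrow> bool list \<times> real" where
  "itinerary z 0 x = ([], 0)"
| "itinerary z (Suc n) x = (case itinerary z n x of (u, a) \<Rightarrow>
     if x < a + z (u @ [False]) then (u @ [False], a) else (u @ [True], a + z (u @ [False])))"

text \<open>Induction appends one bit. The left end point is carried along because the next cut is
  made at distance \<open>z (u @ [False])\<close> from it. Half-open intervals keep the two pieces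
  disjoint, and a word of value zero gets the empty interval.\<close>

lemma itinerary_interval:
  assumes z: "cyl_array z"
  shows "\<exists>a\<ge>0. a + z u \<le> 1 \<and> {x \<in> {0..<1}. fst (itinerary z (length u) x) = u} = {a..<a + z u} \<and>
    (\<forall>x\<in>{a..<a + z u}. snd (itinerary z (length u) x) = a)"
proof (induction u rule: rev_induct)
  case Nil
  then show ?case
    using cyl_arrayD(1)[OF z] by (intro exI[of _ 0]) auto
next
  case (snoc d u)
  then obtain a where a: "0 \<le> a" "a + z u \<le> 1"
    "\<And>x. x \<in> {0..<1} \<and> fst (itinerary z (length u) x) = u \<longleftrightarrow> x \<in> {a..<a + z u}"
    "\<And>x. x \<in> {a..<a + z u} \<Longrightarrow> snd (itinerary z (length u) x) = a"
    by blast
  have zu: "z u = z (u @ [False]) + z (u @ [True])" "0 \<le> z (u @ [False])" "0 \<le> z (u @ [True])"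
    using cyl_arrayD[OF z] by blast+
  define a' where "a' = (if d then a + z (u @ [False]) else a)"
  have step: "itinerary z (Suc (length u)) x =
      (if x < a + z (u @ [False]) then (u @ [False], a) else (u @ [True], a + z (u @ [False])))"
    if "x \<in> {a..<a + z u}" for x
    using a(3)[of x] a(4)[of x] that by (auto split: prod.splits)
  have pre: "fst (itinerary z (length u) x) = u" if "fst (itinerary z (Suc (length u)) x) = u @ [d]" for x
    using that by (auto split: prod.splits if_splits)
  have "x \<in> {0..<1} \<and> fst (itinerary z (length (u @ [d])) x) = u @ [d] \<longleftrightarrow> x \<in> {a'..<a' + z (u @ [d])}" for x
  proof (cases "x \<in> {a..<a + z u}")
    case True
    then have "x \<in> {0..<1}" using a(3) by blast
    then show ?thesis
      using step[OF True] True zu by (cases d) (auto simp: a'_def)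
  next
    case False
    then have "\<not> (x \<in> {0..<1} \<and> fst (itinerary z (Suc (length u)) x) = u @ [d])"
      using pre[of x] a(3)[of x] by blast
    moreover have "x \<notin> {a'..<a' + z (u @ [d])}"
      using False zu by (cases d) (auto simp: a'_def)
    ultimately show ?thesis by (metis length_append_singleton)
  qed
  moreover have "snd (itinerary z (length (u @ [d])) x) = a'" if "x \<in> {a'..<a' + z (u @ [d])}" for x
  proof -
    have "x \<in> {a..<a + z u}"
      using that zu by (cases d) (auto simp: a'_def)
    then show ?thesis
      using step[of x] that by (cases d) (auto simp: a'_def)
  qed
  moreover have "0 \<le> a'" "a' + z (u @ [d]) \<le> 1"
    using a zu by (cases d; simp add: a'_def)+
  ultimately show ?case by (intro exI[of _ a']) blast
qed

text \<open>Kolmogorov extension by simulation: the law of the infinite itinerary of a uniform point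
  gives each cylinder the length of its interval.\<close>

lemma ex_cantor_measure:
  assumes z: "cyl_array z"
  shows "\<exists>Q. prob_space Q \<and> sets Q = sets cantor \<and> (\<forall>u. measure Q (cyl u) = z u)"
proof -
  define \<sigma> where "\<sigma> x i = last (fst (itinerary z (Suc i) x))" for x i
  have \<sigma>: "fst (itinerary z n x) = map (\<sigma> x) [0..<n]" for n x
  proof (induction n)
    case (Suc n)
    have "\<exists>d. fst (itinerary z (Suc n) x) = fst (itinerary z n x) @ [d]"
      by (auto split: prod.splits)
    then obtain d where d: "fst (itinerary z (Suc n) x) = fst (itinerary z n x) @ [d]" by blast
    then have "d = \<sigma> x n" by (simp add: \<sigma>_def del: itinerary.simps)
    then show ?case using d Suc by simp
  qed simp
  define U where "U = restrict_space lborel {0..<1::real}"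
  have U: "prob_space U"
    unfolding U_def by (intro prob_space_restrict_space) auto
  have sets: "{x \<in> {0..<1}. fst (itinerary z (length u) x) = u} \<in> sets U"
    and measure: "measure U {x \<in> {0..<1}. fst (itinerary z (length u) x) = u} = z u" for u
  proof -
    obtain a where a: "0 \<le> a" "a + z u \<le> 1"
      "{x \<in> {0..<1}. fst (itinerary z (length u) x) = u} = {a..<a + z u}"
      using itinerary_interval[OF z, of u] by blast
    have "0 \<le> z u" using z by (rule cyl_arrayD)
    have sub: "{a..<a + z u} \<subseteq> {0..<1}" using a by auto
    show "{x \<in> {0..<1}. fst (itinerary z (length u) x) = u} \<in> sets U"
      unfolding a(3) U_def using sub by (subst sets_restrict_space_iff) auto
    show "measure U {x \<in> {0..<1}. fst (itinerary z (length u) x) = u} = z u"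
      unfolding a(3) U_def using sub \<open>0 \<le> z u\<close> by (subst measure_restrict_space) auto
  qed
  have space_U: "space U = {0..<1}" by (simp add: U_def space_restrict_space)
  have vim: "\<sigma> -` cyl u \<inter> space U = {x \<in> {0..<1}. fst (itinerary z (length u) x) = u}" for u
    by (auto simp: space_U \<sigma> mem_cyl_iff)
  have "\<sigma> \<in> U \<rightarrow>\<^sub>M sigma UNIV (insert {} (range cyl))"
    using sets vim by (intro measurable_sigma_sets[where \<Omega> = UNIV and A = "insert {} (range cyl)"]) auto
  then have m: "\<sigma> \<in> U \<rightarrow>\<^sub>M cantor"
    by (subst measurable_cong_sets[OF refl, of _ "sigma UNIV (insert {} (range cyl))"])
      (auto simp: sets_cantor)
  interpret prob_space U by fact
  show ?thesis
    using m vim measure prob_space_distr[OF m]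
    by (intro exI[of _ "distr U cantor \<sigma>"]) (simp add: measure_distr)
qed

text \<open>The default value makes the map total, so that it can be composed with measurable
  array-valued maps that are consistent only almost everywhere.\<close>

definition cantor_measure :: "(bool list \<Rightarrow> real) \<Rightarrow> (nat \<Rightarrow> bool) measure" where
  "cantor_measure z = (if cyl_array z
     then SOME Q. prob_space Q \<and> sets Q = sets cantor \<and> (\<forall>u. measure Q (cyl u) = z u)
     else return cantor (\<lambda>_. False))"

lemma cantor_measure:
  shows prob_space_cantor_measure: "prob_space (cantor_measure z)"
    and sets_cantor_measure: "sets (cantor_measure z) = sets cantor"
    and measure_cantor_measure: "cyl_array z \<Longrightarrow> measure (cantor_measure z) (cyl u) = z u"
proof -
  have *: "cyl_array z \<Longrightarrow> prob_space (cantor_measure z) \<and> sets (cantor_measure z) = sets cantor \<and>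
    (\<forall>u. measure (cantor_measure z) (cyl u) = z u)"
    unfolding cantor_measure_def using someI_ex[OF ex_cantor_measure[of z]] by auto
  show "prob_space (cantor_measure z)" "sets (cantor_measure z) = sets cantor"
    using * by (cases "cyl_array z"; simp add: cantor_measure_def prob_space_return)+
  show "cyl_array z \<Longrightarrow> measure (cantor_measure z) (cyl u) = z u"
    using * by simp
qed

text \<open>Consistency consists of countably many relations between coordinates and is measurable;
  on consistent arrays a cylinder probability is a coordinate, elsewhere it is constant.\<close>

lemma measurable_cantor_measure [measurable]:
  "cantor_measure \<in> (\<Pi>\<^sub>M u\<in>UNIV. borel) \<rightarrow>\<^sub>M prob_algebra cantor"
proof (rule measurable_prob_algebra_generated[OF sets_cantor Int_stable_cyl])
  fix A assume "A \<in> insert {} (range cyl)"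
  then consider "A = {}" | u where "A = cyl u" by auto
  then show "(\<lambda>z. emeasure (cantor_measure z) A) \<in> borel_measurable (\<Pi>\<^sub>M u\<in>UNIV. borel)"
  proof cases
    case 2
    have *[measurable]: "(\<lambda>z::bool list \<Rightarrow> real. z v) \<in> borel_measurable (\<Pi>\<^sub>M u\<in>UNIV. borel)" for v
      by (rule measurable_component_singleton) simp
    have [measurable]: "Measurable.pred (\<Pi>\<^sub>M u\<in>UNIV. borel) cyl_array"
      unfolding cyl_array_def
      by (intro pred_intros_logic pred_intros_countable; unfold Measurable.pred_def;
          intro borel_measurable_eq borel_measurable_le borel_measurable_add borel_measurable_const *)
    have "emeasure (cantor_measure z) A = (if cyl_array z then ennreal (z u) else indicator A (\<lambda>_. False))" for z
    proof (cases "cyl_array z")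
      case True
      interpret prob_space "cantor_measure z" by (rule prob_space_cantor_measure)
      show ?thesis using True measure_cantor_measure by (simp add: 2 emeasure_eq_measure)
    next
      case False
      then show ?thesis by (simp add: 2 cantor_measure_def)
    qed
    then show ?thesis by simp
  qed simp
qed (auto simp: prob_space_cantor_measure sets_cantor_measure)

lemma cyl_array_measure:
  assumes "prob_space Q" "sets Q = sets cantor"
  shows "cyl_array (\<lambda>u. measure Q (cyl u))"
proof -
  interpret prob_space Q by fact
  have [measurable]: "cyl u \<in> sets Q" for u by (simp add: assms)
  have "cyl [] = space Q"
    using sets_eq_imp_space_eq[OF assms(2)] by (simp add: cyl_def)
  moreover have "measure Q (cyl u) = measure Q (cyl (u @ [False])) + measure Q (cyl (u @ [True]))" for u
  proof -
    have "cyl (u @ [False]) \<union> cyl (u @ [True]) = cyl u" "cyl (u @ [False]) \<inter> cyl (u @ [True]) = {}"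
      by (auto simp: cyl_def nth_append less_Suc_eq)
    then show ?thesis
      using finite_measure_Union[of "cyl (u @ [False])" "cyl (u @ [True])"] by simp
  qed
  ultimately show ?thesis
    unfolding cyl_array_def using prob_space by (intro conjI allI) (metis, rule measure_nonneg, blast)
qed

lemma cantor_measure_of_measure:
  assumes "prob_space Q" "sets Q = sets cantor"
  shows "cantor_measure (\<lambda>u. measure Q (cyl u)) = Q"
  using assms prob_space_cantor_measure sets_cantor_measure cyl_array_measure[OF assms]
  by (intro cantor_measure_eqI) (auto simp: measure_cantor_measure)

section \<open>Compactness of probabilities on bit sequences\<close>

lemma bounded_seq_pointwise_convergent_subseq:
  fixes a :: "nat \<Rightarrow> 'i::countable \<Rightarrow> real"
  assumes "\<And>n i. a n i \<in> {0..1}"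
  obtains r z where "strict_mono (r :: nat \<Rightarrow> nat)" "\<And>i. (\<lambda>n. a (r n) i) \<longlonglongrightarrow> z i"
proof -
  \<comment> \<open>Tychonoff gives compactness; over a countable index type the product is
    metrizable, so that subsequences can be extracted.\<close>
  have "compact (Pi\<^sub>E (UNIV :: 'i set) (\<lambda>_. {0..1::real}))"
    using compactin_PiE[of "\<lambda>_. euclideanreal" "UNIV :: 'i set" "\<lambda>_. {0..1::real}"]
    by (simp add: euclidean_product_topology)
  then have "seq_compact (Pi\<^sub>E (UNIV :: 'i set) (\<lambda>_. {0..1::real}))"
    by (simp add: compact_eq_seq_compact_metric)
  then obtain r z where "strict_mono r" "(a \<circ> r) \<longlonglongrightarrow> z"
    using assms unfolding seq_compact_def by (metis PiE_UNIV_domain UNIV_I PiE_I UNIV_eq_I iso_tuple_UNIV_I)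
  moreover have "(\<lambda>n. a (r n) i) \<longlonglongrightarrow> z i" for i
    using continuous_on_tendsto_compose[OF continuous_on_product_coordinates[of i] calculation(2)]
    by (simp add: comp_def)
  ultimately show ?thesis using that by blast
qed

text \<open>The conditions of \<open>cyl_array\<close>, total mass one among them, are closed under
  pointwise limits. This takes the place of tightness.\<close>

lemma cantor_prob_compact:
  assumes Q: "\<And>n. prob_space (Q n)" "\<And>n. sets (Q n) = sets cantor"
  obtains r L where "strict_mono (r :: nat \<Rightarrow> nat)" "prob_space L" "sets L = sets cantor"
    "\<And>u. (\<lambda>n. measure (Q (r n)) (cyl u)) \<longlonglongrightarrow> measure L (cyl u)"
proof -
  obtain r z where r: "strict_mono (r :: nat \<Rightarrow> nat)" and z: "\<And>u. (\<lambda>n. measure (Q (r n)) (cyl u)) \<longlonglongrightarrow> z u"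
    using bounded_seq_pointwise_convergent_subseq[of "\<lambda>n u. measure (Q n) (cyl u)"]
      prob_space.prob_le_1[OF Q(1)] by auto
  have *: "cyl_array (\<lambda>u. measure (Q (r n)) (cyl u))" for n
    using Q by (rule cyl_array_measure)
  have "cyl_array z"
    unfolding cyl_array_def
  proof (intro conjI allI)
    show "z [] = 1"
      using LIMSEQ_unique[OF z[of "[]"], of 1] cyl_arrayD(1)[OF *] by simp
    show "0 \<le> z u" for u
      by (rule LIMSEQ_le_const[OF z]) simp
    show "z u = z (u @ [False]) + z (u @ [True])" for u
    proof (rule LIMSEQ_unique[OF z])
      show "(\<lambda>n. measure (Q (r n)) (cyl u)) \<longlonglongrightarrow> z (u @ [False]) + z (u @ [True])"
        using tendsto_add[OF z[of "u @ [False]"] z[of "u @ [True]"]] unfolding cyl_arrayD(3)[OF *, symmetric] .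
    qed
  qed
  then show ?thesis
    using that[OF r prob_space_cantor_measure[of z] sets_cantor_measure] z by (simp add: measure_cantor_measure)
qed

section \<open>Coding Polish spaces and spaces of measures\<close>

instance prod :: (polish_space, polish_space) polish_space ..

text \<open>The measurable left inverse makes the set of codes measurable: it consists of the
  \<open>b\<close> with \<open>h (\<phi> b) = b\<close>. Limit arguments have to show that a
  limiting law is carried by such a set.\<close>

definition coding :: "('x::topological_space \<Rightarrow> nat \<Rightarrow> bool) \<Rightarrow> ((nat \<Rightarrow> bool) \<Rightarrow> 'x) \<Rightarrow> bool" where
  "coding h \<phi> \<longleftrightarrow> h \<in> borel \<rightarrow>\<^sub>M cantor \<and> \<phi> \<in> cantor \<rightarrow>\<^sub>M borel \<and> (\<forall>x. \<phi> (h x) = x)"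

lemma codingD:
  assumes "coding h \<phi>"
  shows "h \<in> borel \<rightarrow>\<^sub>M cantor" "\<phi> \<in> cantor \<rightarrow>\<^sub>M borel" "\<phi> (h x) = x"
  using assms by (auto simp: coding_def)

lemma measurable_eq_cantor [measurable (raw)]:
  assumes "f \<in> M \<rightarrow>\<^sub>M cantor" "g \<in> M \<rightarrow>\<^sub>M cantor"
  shows "Measurable.pred M (\<lambda>x. f x = g x)"
proof -
  note [measurable] = measurable_compose[OF assms(1) measurable_cantor_bit]
    measurable_compose[OF assms(2) measurable_cantor_bit]
  show ?thesis
    unfolding fun_eq_iff by measurable
qed

definition base_code :: "(nat \<Rightarrow> 'x set) \<Rightarrow> 'x \<Rightarrow> nat \<Rightarrow> bool" where
  "base_code U x i \<longleftrightarrow> x \<in> U i"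

text \<open>A point is recovered as the limit of sample points of ever smaller base sets that its
  code declares to contain it; completeness enters through the equivalence of Cauchy and convergent
  sequences.\<close>

lemma ex_base_decode:
  fixes U :: "nat \<Rightarrow> 'x::polish_space set"
  assumes U: "topological_basis (range U)"
  shows "\<exists>\<phi>. coding (base_code U) \<phi>"
proof -
  have oU: "open (U i)" for i
    using U by (auto intro: topological_basis_open)
  \<comment> \<open>The value is arbitrary for an empty base set, but the index selected from a
    genuine code satisfies \<open>x \<in> U k\<close>.\<close>
  define pt where "pt i = (SOME x. x \<in> U i)" for i
  define small where "small j i \<longleftrightarrow> (\<forall>x\<in>U i. \<forall>y\<in>U i. dist x y \<le> 1 / real (Suc j))" for i j
  define f where "f j b = pt (LEAST i. b i \<and> small j i)" for j b
  \<comment> \<open>A bit sequence that is not a code may produce a divergent sequence; the default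
    keeps \<phi> total and measurable.\<close>
  define \<phi> where "\<phi> b = (if Cauchy (\<lambda>j. f j b) then lim (\<lambda>j. f j b) else undefined)" for b
  have f[measurable]: "f j \<in> borel_measurable cantor" for j
    unfolding f_def by (rule measurable_compose[where g = pt and N = "count_space UNIV"]) measurable
  have "\<phi> \<in> borel_measurable cantor"
  proof (rule borel_measurable_LIMSEQ_metric)
    show "(\<lambda>b. if Cauchy (\<lambda>j. f j b) then f j b else undefined) \<in> borel_measurable cantor" for j
      by measurable
    show "(\<lambda>j. if Cauchy (\<lambda>j. f j b) then f j b else undefined) \<longlonglongrightarrow> \<phi> b" for b
      by (auto simp: \<phi>_def Cauchy_convergent_iff convergent_LIMSEQ_iff)
  qed
  moreover have "\<phi> (base_code U x) = x" for x
  proof -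
    have close: "dist (f j (base_code U x)) x \<le> 1 / real (Suc j)" for j
    proof -
      obtain V where "V \<in> range U" "x \<in> V" "V \<subseteq> ball x (1 / (2 * real (Suc j)))"
        using topological_basisE[OF U, of "ball x (1 / (2 * real (Suc j)))" x] by auto
      then obtain i where i: "x \<in> U i" "U i \<subseteq> ball x (1 / (2 * real (Suc j)))" by blast
      have "small j i"
        unfolding small_def
      proof (intro ballI)
        fix y z assume "y \<in> U i" "z \<in> U i"
        then have "dist x y < 1 / (2 * real (Suc j))" "dist x z < 1 / (2 * real (Suc j))"
          using i(2) by auto
        then have "dist y z < 1 / (2 * real (Suc j)) + 1 / (2 * real (Suc j))"
          using dist_triangle3[of y z x] by linarith
        then show "dist y z \<le> 1 / real (Suc j)" by (simp add: field_simps)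
      qed
      define k where "k = (LEAST i. base_code U x i \<and> small j i)"
      have "base_code U x k \<and> small j k"
        unfolding k_def by (rule LeastI[of _ i]) (use i \<open>small j i\<close> in \<open>simp add: base_code_def\<close>)
      then have k: "x \<in> U k" "small j k" by (auto simp: base_code_def)
      have "pt k \<in> U k"
        unfolding pt_def using k(1) by (rule someI)
      then show ?thesis
        using k unfolding f_def k_def[symmetric] by (simp add: small_def)
    qed
    have lim0: "(\<lambda>j. 1 / real (Suc j)) \<longlonglongrightarrow> 0"
      using LIMSEQ_inverse_real_of_nat by (simp add: inverse_eq_divide)
    have "(\<lambda>j. dist (f j (base_code U x)) x) \<longlonglongrightarrow> 0"
    proof (rule tendsto_sandwich[OF _ _ tendsto_const lim0])
      show "\<forall>\<^sub>F j in sequentially. 0 \<le> dist (f j (base_code U x)) x"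
        by (intro always_eventually allI zero_le_dist)
      show "\<forall>\<^sub>F j in sequentially. dist (f j (base_code U x)) x \<le> 1 / real (Suc j)"
        by (intro always_eventually allI close)
    qed
    then have lim: "(\<lambda>j. f j (base_code U x)) \<longlonglongrightarrow> x"
      by (rule tendsto_dist_iff[THEN iffD2])
    then show ?thesis
      unfolding \<phi>_def using LIMSEQ_imp_Cauchy[OF lim] limI[OF lim] by simp
  qed
  moreover have "base_code U \<in> borel \<rightarrow>\<^sub>M cantor"
    using oU by (intro measurable_into_cantor) (simp add: base_code_def pred_def)
  ultimately show ?thesis
    unfolding coding_def by blast
qed

section \<open>Laws of codes, and codes of measures\<close>

definition law :: "('x::topological_space \<Rightarrow> nat \<Rightarrow> bool) \<Rightarrow> 'x borel_prob \<Rightarrow> (nat \<Rightarrow> bool) measure" where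
  "law h \<mu> = distr (to_measure \<mu>) cantor h"

definition cyl_prob :: "('x::topological_space \<Rightarrow> nat \<Rightarrow> bool) \<Rightarrow> 'x borel_prob \<Rightarrow> bool list \<Rightarrow> real" where
  "cyl_prob h \<mu> u = measure (to_measure \<mu>) {x. h x \<in> cyl u}"

lemma sets_law [simp, measurable_cong]: "sets (law h \<mu>) = sets cantor"
  by (simp add: law_def)

lemma measurable_to_measure_iff: "f \<in> to_measure \<mu> \<rightarrow>\<^sub>M N \<longleftrightarrow> f \<in> borel \<rightarrow>\<^sub>M N"
  by (rule arg_cong2[where f = "(\<in>)"]) (auto intro: measurable_cong_sets)

lemma prob_space_law:
  assumes "h \<in> borel \<rightarrow>\<^sub>M cantor"
  shows "prob_space (law h \<mu>)"
  using assms unfolding law_def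
  by (intro prob_space.prob_space_distr prob_space_to_measure) (simp add: measurable_to_measure_iff)

lemma measure_law:
  assumes "h \<in> borel \<rightarrow>\<^sub>M cantor" "A \<in> sets cantor"
  shows "measure (law h \<mu>) A = measure (to_measure \<mu>) {x. h x \<in> A}"
  using assms unfolding law_def
  by (subst measure_distr) (auto simp: measurable_to_measure_iff vimage_def)

lemma measure_law_cyl:
  assumes "h \<in> borel \<rightarrow>\<^sub>M cantor"
  shows "measure (law h \<mu>) (cyl u) = cyl_prob h \<mu> u"
  using assms by (simp add: measure_law cyl_prob_def)

definition of_measure :: "'x::topological_space measure \<Rightarrow> 'x borel_prob" where
  "of_measure = Abs_borel_prob"

lemma to_measure_of_measure:
  "prob_space M \<Longrightarrow> sets M = sets borel \<Longrightarrow> to_measure (of_measure M) = M"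
  unfolding of_measure_def by (rule Abs_borel_prob_inverse) simp

lemma borel_prob_eqI: "to_measure \<mu> = to_measure \<nu> \<Longrightarrow> \<mu> = \<nu>"
  by (simp add: to_measure_inject)

lemma AE_coding:
  assumes "coding h \<phi>"
  shows "AE b in law h \<mu>. h (\<phi> b) = b"
proof -
  note [measurable] = codingD(1,2)[OF assms]
  have "{b \<in> space cantor. h (\<phi> b) = b} \<in> sets cantor"
    by measurable
  then show ?thesis
    unfolding law_def using codingD[OF assms] by (subst AE_distr_iff) (auto simp: measurable_to_measure_iff)
qed

lemma distr_law:
  assumes "coding h \<phi>"
  shows "distr (law h \<mu>) borel \<phi> = to_measure \<mu>"
proof -
  have "distr (law h \<mu>) borel \<phi> = distr (to_measure \<mu>) borel (\<phi> \<circ> h)"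
    unfolding law_def using codingD[OF assms] by (intro distr_distr) (auto simp: measurable_to_measure_iff)
  also have "\<phi> \<circ> h = (\<lambda>x. x)"
    using codingD[OF assms] by auto
  finally show ?thesis
    by (simp add: distr_id2)
qed

definition decode_prob :: "((nat \<Rightarrow> bool) \<Rightarrow> 'x::topological_space) \<Rightarrow> (bool list \<Rightarrow> real) \<Rightarrow> 'x borel_prob" where
  "decode_prob \<phi> z = of_measure (distr (cantor_measure z) borel \<phi>)"

lemma measurable_cantor_measure_iff: "f \<in> cantor_measure z \<rightarrow>\<^sub>M N \<longleftrightarrow> f \<in> cantor \<rightarrow>\<^sub>M N"
  using measurable_cong_sets[OF sets_cantor_measure refl] by blast

lemma to_measure_decode_prob:
  assumes "\<phi> \<in> cantor \<rightarrow>\<^sub>M borel"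
  shows "to_measure (decode_prob \<phi> z) = distr (cantor_measure z) borel \<phi>"
  unfolding decode_prob_def using assms
  by (intro to_measure_of_measure prob_space.prob_space_distr prob_space_cantor_measure)
    (auto simp: measurable_cantor_measure_iff)

lemma cantor_measure_cyl_prob:
  assumes "h \<in> borel \<rightarrow>\<^sub>M cantor"
  shows "cantor_measure (cyl_prob h \<mu>) = law h \<mu>"
  using cantor_measure_of_measure[OF prob_space_law[OF assms], of \<mu>] assms
  by (simp add: measure_law_cyl eta_contract_eq)

lemma decode_cyl_prob:
  assumes "coding h \<phi>"
  shows "decode_prob \<phi> (cyl_prob h \<mu>) = \<mu>"
  by (rule borel_prob_eqI) (simp add: to_measure_decode_prob codingD[OF assms] cantor_measure_cyl_prob distr_law[OF assms])

lemma measurable_decode_prob: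
  fixes \<phi> :: "(nat \<Rightarrow> bool) \<Rightarrow> 'x::polish_space"
  assumes "\<phi> \<in> cantor \<rightarrow>\<^sub>M borel"
  shows "decode_prob \<phi> \<in> (\<Pi>\<^sub>M u\<in>UNIV. borel) \<rightarrow>\<^sub>M borel"
  by (rule borel_measurable_borel_probI, unfold to_measure_decode_prob[OF assms])
    (rule measurable_compose[OF measurable_cantor_measure measurable_distr_prob_space[OF assms]])

lemma measurable_measure_to_measure:
  fixes A :: "'x::polish_space set"
  assumes "A \<in> sets borel"
  shows "(\<lambda>\<mu>. measure (to_measure \<mu>) A) \<in> borel_measurable borel"
  using assms measurable_prob_algebraD[OF measurable_to_measure]
  by (intro measure_measurable_subprob_algebra2[where N = borel]) auto

lemma sets_coding_cyl:
  assumes "h \<in> borel \<rightarrow>\<^sub>M cantor"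
  shows "{x. h x \<in> cyl u} \<in> sets borel"
  using measurable_sets[OF assms sets_cyl, of u] by (simp add: vimage_def)

lemma measurable_cyl_prob:
  fixes h :: "'x::polish_space \<Rightarrow> nat \<Rightarrow> bool"
  assumes "h \<in> borel \<rightarrow>\<^sub>M cantor"
  shows "(\<lambda>\<mu>. cyl_prob h \<mu> u) \<in> borel_measurable borel"
  unfolding cyl_prob_def using assms by (intro measurable_measure_to_measure sets_coding_cyl)

lemma cyl_prob_01:
  shows "0 \<le> cyl_prob h \<mu> u" "cyl_prob h \<mu> u \<le> 1"
  by (simp_all add: cyl_prob_def prob_space.prob_le_1)

text \<open>Digit \<open>0\<close> is the integer part, so that \<open>1\<close> is recovered from its digits too.\<close>

definition real_bit :: "real \<Rightarrow> nat \<Rightarrow> bool" where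
  "real_bit x k \<longleftrightarrow> odd \<lfloor>2 ^ k * x\<rfloor>"

definition bits_real :: "(nat \<Rightarrow> bool) \<Rightarrow> real" where
  "bits_real b = (\<Sum>k. if b k then (1 / 2) ^ k else 0)"

lemma summable_bits: "summable (\<lambda>k. if b k then (1 / 2 :: real) ^ k else 0)"
  by (rule summable_comparison_test'[of "\<lambda>k. (1 / 2) ^ k" 0]) auto

text \<open>Passing from \<open>y\<close> to \<open>2 * y\<close> doubles the integer part and adds
  the next digit, so the partial sums are dyadic truncations of \<open>x\<close>.\<close>

lemma sum_real_bit:
  assumes "0 \<le> x" "x \<le> 1"
  shows "(\<Sum>k<Suc n. if real_bit x k then (1 / 2 :: real) ^ k else 0) = \<lfloor>2 ^ n * x\<rfloor> / 2 ^ n"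
proof (induction n)
  case 0
  have "\<lfloor>x\<rfloor> = 0 \<or> \<lfloor>x\<rfloor> = 1"
    using assms by (simp add: floor_eq_iff) linarith
  then show ?case by (auto simp: real_bit_def)
next
  case (Suc n)
  have "\<lfloor>2 * y\<rfloor> = 2 * \<lfloor>y\<rfloor> + (if odd \<lfloor>2 * y\<rfloor> then 1 else 0)" for y :: real
  proof -
    have "2 * \<lfloor>y\<rfloor> \<le> \<lfloor>2 * y\<rfloor>" "\<lfloor>2 * y\<rfloor> \<le> 2 * \<lfloor>y\<rfloor> + 1" by linarith+
    then show ?thesis by presburger
  qed
  from arg_cong[where f = real_of_int, OF this[of "2 ^ n * x"]]
  have "real_of_int \<lfloor>2 ^ Suc n * x\<rfloor> = 2 * real_of_int \<lfloor>2 ^ n * x\<rfloor> + (if real_bit x (Suc n) then 1 else 0)"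
    unfolding real_bit_def power_Suc mult.assoc by (simp only: of_int_add of_int_mult of_int_numeral if_distrib of_int_0 of_int_1)
  then show ?case
    unfolding sum.lessThan_Suc[of _ "Suc n"] Suc by (simp add: field_simps power_one_over)
qed

lemma bits_real_bit:
  assumes "0 \<le> x" "x \<le> 1"
  shows "bits_real (real_bit x) = x"
proof -
  have "(\<lambda>n. \<Sum>k<Suc n. if real_bit x k then (1 / 2 :: real) ^ k else 0) \<longlonglongrightarrow> bits_real (real_bit x)"
    using summable_LIMSEQ[OF summable_bits] unfolding bits_real_def by (rule LIMSEQ_Suc)
  moreover have "(\<lambda>n. \<Sum>k<Suc n. if real_bit x k then (1 / 2 :: real) ^ k else 0) \<longlonglongrightarrow> x"
  proof (rule tendsto_sandwich)
    show "(\<lambda>n. x - (1 / 2) ^ n) \<longlonglongrightarrow> x"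
      using tendsto_diff[OF tendsto_const LIMSEQ_realpow_zero[of "1 / 2 :: real"], of x] by simp
    have "x - (1 / 2) ^ n \<le> \<lfloor>2 ^ n * x\<rfloor> / 2 ^ n" "\<lfloor>2 ^ n * x\<rfloor> / 2 ^ n \<le> x" for n
    proof -
      have "2 ^ n * x - 1 \<le> \<lfloor>2 ^ n * x\<rfloor>" "\<lfloor>2 ^ n * x\<rfloor> \<le> 2 ^ n * x" by linarith+
      then have "(2 ^ n * x - 1) / 2 ^ n \<le> \<lfloor>2 ^ n * x\<rfloor> / 2 ^ n" "\<lfloor>2 ^ n * x\<rfloor> / 2 ^ n \<le> 2 ^ n * x / 2 ^ n"
        by (simp_all only: divide_right_mono zero_le_power zero_le_numeral)
      then show "x - (1 / 2) ^ n \<le> \<lfloor>2 ^ n * x\<rfloor> / 2 ^ n" "\<lfloor>2 ^ n * x\<rfloor> / 2 ^ n \<le> x"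
        by (simp_all add: diff_divide_distrib power_one_over)
    qed
    then show "\<forall>\<^sub>F n in sequentially. x - (1 / 2) ^ n \<le> (\<Sum>k<Suc n. if real_bit x k then (1 / 2) ^ k else 0)"
      "\<forall>\<^sub>F n in sequentially. (\<Sum>k<Suc n. if real_bit x k then (1 / 2) ^ k else 0) \<le> x"
      unfolding sum_real_bit[OF assms] by simp_all
  qed simp
  ultimately show ?thesis by (rule LIMSEQ_unique)
qed

text \<open>The digits from position \<open>N\<close> on contribute at most
  \<open>2 * (1 / 2) ^ N\<close>, hence the bound \<open>\<epsilon> / 2\<close> on the power. Only
  this direction is continuous: \<open>real_bit\<close> has jumps.\<close>

lemma tame_bits_real: "tame bits_real"
  unfolding tame_def
proof (intro allI impI)
  fix \<epsilon> :: real assume "\<epsilon> > 0"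
  then obtain N where N: "(1 / 2 :: real) ^ N < \<epsilon> / 2"
    using real_arch_pow_inv[of "\<epsilon> / 2" "1 / 2"] by auto
  have "\<bar>bits_real b - bits_real b'\<bar> \<le> \<epsilon>" if eq: "\<forall>i<N. b i = b' i" for b b'
  proof -
    have s: "bits_real c = (\<Sum>k<N. if c k then (1 / 2) ^ k else 0) + (\<Sum>k. if c (k + N) then (1 / 2) ^ (k + N) else 0)" for c
      unfolding bits_real_def using suminf_split_initial_segment[OF summable_bits[of c], of N] by simp
    have sm: "summable (\<lambda>k. (1 / 2 :: real) ^ (k + N))"
      by (rule summable_ignore_initial_segment) simp
    have sc: "summable (\<lambda>k. if c (k + N) then (1 / 2 :: real) ^ (k + N) else 0)" for c
      using summable_ignore_initial_segment[OF summable_bits[of c], of N] .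
    have t: "(\<Sum>k. (1 / 2 :: real) ^ (k + N)) = 2 * (1 / 2) ^ N"
      unfolding power_add using suminf_mult2[of "\<lambda>k. (1 / 2 :: real) ^ k" "(1 / 2) ^ N"] suminf_geometric[of "1 / 2 :: real"]
      by simp
    define T where "T c = (\<Sum>k. if c (k + N) then (1 / 2 :: real) ^ (k + N) else 0)" for c
    have "0 \<le> T c" for c
      unfolding T_def using sc[of c] by (intro suminf_nonneg) auto
    moreover have "T c \<le> 2 * (1 / 2) ^ N" for c
      unfolding T_def t[symmetric] using sc[of c] sm by (intro suminf_le) auto
    ultimately have "\<bar>T b - T b'\<bar> \<le> 2 * (1 / 2) ^ N"
      by (smt (verit))
    moreover have "(\<Sum>k<N. if b k then (1 / 2 :: real) ^ k else 0) = (\<Sum>k<N. if b' k then (1 / 2) ^ k else 0)"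
      using eq by (intro sum.cong) auto
    ultimately show ?thesis
      using N unfolding s[of b] s[of b'] T_def[symmetric] by simp
  qed
  then show "\<exists>N. \<forall>b b'. (\<forall>i<N. b i = b' i) \<longrightarrow> \<bar>bits_real b - bits_real b'\<bar> \<le> \<epsilon>" by blast
qed

definition array_of :: "(nat \<Rightarrow> bool) \<Rightarrow> bool list \<Rightarrow> real" where
  "array_of b u = bits_real (\<lambda>k. b (to_nat (u, k)))"

definition prob_code :: "('x::topological_space \<Rightarrow> nat \<Rightarrow> bool) \<Rightarrow> 'x borel_prob \<Rightarrow> nat \<Rightarrow> bool" where
  "prob_code h \<mu> i = (case from_nat i of (u, k) \<Rightarrow> real_bit (cyl_prob h \<mu> u) k)"

definition prob_decode :: "((nat \<Rightarrow> bool) \<Rightarrow> 'x::topological_space) \<Rightarrow> (nat \<Rightarrow> bool) \<Rightarrow> 'x borel_prob" where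
  "prob_decode \<phi> b = decode_prob \<phi> (array_of b)"

lemma array_of_prob_code: "array_of (prob_code h \<mu>) = cyl_prob h \<mu>"
  by (auto simp: fun_eq_iff array_of_def prob_code_def bits_real_bit cyl_prob_01 eta_contract_eq)

lemma tame_array_of: "tame (\<lambda>b. array_of b u)"
  using tame_reindex[OF tame_bits_real, of "\<lambda>k. to_nat (u, k)"] by (simp add: array_of_def comp_def)

lemma array_of_nonneg: "0 \<le> array_of b u"
  unfolding array_of_def bits_real_def by (intro suminf_nonneg summable_bits) auto

lemma measurable_array_of [measurable]: "array_of \<in> cantor \<rightarrow>\<^sub>M (\<Pi>\<^sub>M u\<in>UNIV. borel)"
  by (intro measurable_PiM_single') (auto simp: tame_measurable[OF tame_array_of])

lemma coding_prob:
  fixes h :: "'x::polish_space \<Rightarrow> nat \<Rightarrow> bool"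
  assumes "coding h \<phi>"
  shows "coding (prob_code h) (prob_decode \<phi>)"
  unfolding coding_def
proof (intro conjI allI)
  show "prob_decode \<phi> (prob_code h \<mu>) = \<mu>" for \<mu>
    by (simp add: prob_decode_def array_of_prob_code decode_cyl_prob[OF assms])
  show "prob_decode \<phi> \<in> cantor \<rightarrow>\<^sub>M borel"
    unfolding prob_decode_def
    by (rule measurable_compose[OF measurable_array_of measurable_decode_prob[OF codingD(2)[OF assms]]])
  show "prob_code h \<in> borel \<rightarrow>\<^sub>M cantor"
  proof (rule measurable_into_cantor)
    fix i
    obtain u k where uk: "(from_nat i :: bool list \<times> nat) = (u, k)" by (cases "from_nat i :: bool list \<times> nat")
    note [measurable] = measurable_cyl_prob[OF codingD(1)[OF assms]]
    show "(\<lambda>\<mu>. prob_code h \<mu> i) \<in> borel \<rightarrow>\<^sub>M count_space UNIV"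
      unfolding prob_code_def uk real_bit_def prod.case by measurable
  qed
qed

section \<open>Codes of pairs and of plans\<close>

definition pair_code where
  "pair_code h1 h2 w i = (if even i then h1 (fst w) (i div 2) else h2 (snd w) (i div 2))"

definition pair_decode where
  "pair_decode \<phi>1 \<phi>2 b = (\<phi>1 (b \<circ> (\<lambda>i. 2 * i)), \<phi>2 (b \<circ> (\<lambda>i. Suc (2 * i))))"

lemma pair_code_comp:
  "pair_code h1 h2 w \<circ> (\<lambda>i. 2 * i) = h1 (fst w)" "pair_code h1 h2 w \<circ> (\<lambda>i. Suc (2 * i)) = h2 (snd w)"
  by (auto simp: pair_code_def)

lemma pair_code_eqI:
  assumes "h1 (fst w) = b \<circ> (\<lambda>i. 2 * i)" "h2 (snd w) = b \<circ> (\<lambda>i. Suc (2 * i))"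
  shows "pair_code h1 h2 w = b"
proof
  show "pair_code h1 h2 w i = b i" for i
    using assms by (cases "even i") (auto simp: pair_code_def elim!: evenE oddE)
qed

lemma borel_measurable_fst_snd:
  "fst \<in> borel_measurable (borel :: ('a::topological_space \<times> 'b::topological_space) measure)"
  "snd \<in> borel_measurable (borel :: ('a::topological_space \<times> 'b::topological_space) measure)"
  by (auto intro!: borel_measurable_continuous_onI continuous_intros)

lemma coding_pair:
  fixes h1 :: "'x::second_countable_topology \<Rightarrow> nat \<Rightarrow> bool" and h2 :: "'y::second_countable_topology \<Rightarrow> nat \<Rightarrow> bool"
  assumes "coding h1 \<phi>1" "coding h2 \<phi>2"
  shows "coding (pair_code h1 h2) (pair_decode \<phi>1 \<phi>2)"
  unfolding coding_def
proof (intro conjI allI)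
  note [measurable] = codingD(1,2)[OF assms(1)] codingD(1,2)[OF assms(2)] borel_measurable_fst_snd
    measurable_compose[OF measurable_compose[OF borel_measurable_fst_snd(1) codingD(1)[OF assms(1)]] measurable_cantor_bit]
    measurable_compose[OF measurable_compose[OF borel_measurable_fst_snd(2) codingD(1)[OF assms(2)]] measurable_cantor_bit]
  show "pair_code h1 h2 \<in> borel \<rightarrow>\<^sub>M cantor"
    by (rule measurable_into_cantor) (simp add: pair_code_def)
  show "pair_decode \<phi>1 \<phi>2 \<in> cantor \<rightarrow>\<^sub>M borel"
    unfolding pair_decode_def by measurable
  show "pair_decode \<phi>1 \<phi>2 (pair_code h1 h2 w) = w" for w
    by (simp add: pair_decode_def pair_code_comp codingD[OF assms(1)] codingD[OF assms(2)])
qed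

text \<open>A marginal is visible in the code of a plan by selecting bits: \<gamma> lists the
  positions at which \<open>h w\<close> stores the code of \<open>f w\<close>.\<close>

lemma cyl_prob_marginal:
  assumes "h1 \<in> borel \<rightarrow>\<^sub>M cantor" "f \<in> borel \<rightarrow>\<^sub>M borel" "h \<in> borel \<rightarrow>\<^sub>M cantor" "\<And>w. h w \<circ> \<gamma> = h1 (f w)"
  shows "cyl_prob h1 (pushforward f \<pi>) s = measure (law h \<pi>) {b. b \<circ> \<gamma> \<in> cyl s}"
proof -
  have "{b \<in> space cantor. b \<circ> \<gamma> \<in> cyl s} \<in> sets cantor" by measurable
  then have "measure (law h \<pi>) {b. b \<circ> \<gamma> \<in> cyl s} = measure (to_measure \<pi>) {w. h1 (f w) \<in> cyl s}"
    using assms by (subst measure_law) auto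
  also have "\<dots> = cyl_prob h1 (pushforward f \<pi>) s"
    using assms(1,2) sets_coding_cyl[OF assms(1)] unfolding cyl_prob_def to_measure_pushforward[OF assms(2)]
    by (subst measure_distr) (auto simp: measurable_to_measure_iff vimage_def)
  finally show ?thesis by simp
qed

lemma distr_reindex_eq_law:
  assumes L: "prob_space L" "sets L = sets cantor" and h: "h \<in> borel \<rightarrow>\<^sub>M cantor"
    and eq: "\<And>s. measure L {b. b \<circ> \<gamma> \<in> cyl s} = cyl_prob h \<rho> s"
  shows "distr L cantor (\<lambda>b. b \<circ> \<gamma>) = law h \<rho>"
proof -
  interpret prob_space L by fact
  have "(\<lambda>b. b \<circ> \<gamma>) \<in> L \<rightarrow>\<^sub>M cantor"
    using measurable_reindex_cantor measurable_cong_sets[OF L(2) refl] by blast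
  then show ?thesis
    using assms sets_eq_imp_space_eq[OF L(2)]
    by (intro cantor_measure_eqI prob_space_distr prob_space_law)
      (auto simp: measure_distr measure_law_cyl vimage_def)
qed

text \<open>The marginals of a law on pairs of codes decide whether the law lives on codes of points;
  hence no mass is lost in a limit of couplings.\<close>

lemma glue_couplings:
  fixes h1 :: "'x::second_countable_topology \<Rightarrow> nat \<Rightarrow> bool" and h2 :: "'y::second_countable_topology \<Rightarrow> nat \<Rightarrow> bool"
  assumes c1: "coding h1 \<phi>1" and c2: "coding h2 \<phi>2" and L: "prob_space L" "sets L = sets cantor"
    and m1: "\<And>s. measure L {b. b \<circ> (\<lambda>i. 2 * i) \<in> cyl s} = cyl_prob h1 \<mu> s"
    and m2: "\<And>s. measure L {b. b \<circ> (\<lambda>i. Suc (2 * i)) \<in> cyl s} = cyl_prob h2 \<nu> s"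
  defines "\<pi> \<equiv> of_measure (distr L borel (pair_decode \<phi>1 \<phi>2))"
  shows "\<pi> \<in> couplings \<mu> \<nu>" and "cyl_prob (pair_code h1 h2) \<pi> u = measure L (cyl u)"
proof -
  interpret L: prob_space L by fact
  note c = codingD[OF coding_pair[OF c1 c2]]
  have mL: "measurable L N = measurable cantor N" for N :: "'z measure"
    using L(2) by (rule measurable_cong_sets) simp
  have pd: "pair_decode \<phi>1 \<phi>2 \<in> L \<rightarrow>\<^sub>M borel"
    using c(2) by (simp add: mL)
  have to: "to_measure \<pi> = distr L borel (pair_decode \<phi>1 \<phi>2)"
    unfolding \<pi>_def using pd by (intro to_measure_of_measure L.prob_space_distr) auto
  have re: "(\<lambda>b. b \<circ> \<gamma>) \<in> L \<rightarrow>\<^sub>M cantor" for \<gamma>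
    by (simp add: mL)
  have M1: "distr L cantor (\<lambda>b. b \<circ> (\<lambda>i. 2 * i)) = law h1 \<mu>"
    by (rule distr_reindex_eq_law[OF L codingD(1)[OF c1] m1])
  have M2: "distr L cantor (\<lambda>b. b \<circ> (\<lambda>i. Suc (2 * i))) = law h2 \<nu>"
    by (rule distr_reindex_eq_law[OF L codingD(1)[OF c2] m2])
  \<comment> \<open>By the two marginal laws each half of almost every \<open>b\<close> is a code,
    hence so is \<open>b\<close>, which interleaves the halves.\<close>
  have ae: "AE b in L. pair_code h1 h2 (pair_decode \<phi>1 \<phi>2 b) = b"
    using AE_distrD[OF re AE_coding[OF c1, of \<mu>, folded M1]] AE_distrD[OF re AE_coding[OF c2, of \<nu>, folded M2]]
    by eventually_elim (auto intro!: pair_code_eqI simp: pair_decode_def)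
  have "pushforward fst \<pi> = \<mu>"
  proof (rule borel_prob_eqI)
    have "to_measure (pushforward fst \<pi>) = distr L borel (fst \<circ> pair_decode \<phi>1 \<phi>2)"
      unfolding to_measure_pushforward[OF borel_measurable_fst_snd(1)] to
      using borel_measurable_fst_snd(1) pd by (rule distr_distr)
    also have "\<dots> = distr L borel (\<phi>1 \<circ> (\<lambda>b. b \<circ> (\<lambda>i. 2 * i)))"
      by (simp add: pair_decode_def comp_def)
    also have "\<dots> = distr (law h1 \<mu>) borel \<phi>1"
      unfolding M1[symmetric] using codingD(2)[OF c1] re by (rule distr_distr[symmetric])
    finally show "to_measure (pushforward fst \<pi>) = to_measure \<mu>"
      by (simp add: distr_law[OF c1])
  qed
  moreover have "pushforward snd \<pi> = \<nu>"
  proof (rule borel_prob_eqI)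
    have "to_measure (pushforward snd \<pi>) = distr L borel (snd \<circ> pair_decode \<phi>1 \<phi>2)"
      unfolding to_measure_pushforward[OF borel_measurable_fst_snd(2)] to
      using borel_measurable_fst_snd(2) pd by (rule distr_distr)
    also have "\<dots> = distr L borel (\<phi>2 \<circ> (\<lambda>b. b \<circ> (\<lambda>i. Suc (2 * i))))"
      by (simp add: pair_decode_def comp_def)
    also have "\<dots> = distr (law h2 \<nu>) borel \<phi>2"
      unfolding M2[symmetric] using codingD(2)[OF c2] re by (rule distr_distr[symmetric])
    finally show "to_measure (pushforward snd \<pi>) = to_measure \<nu>"
      by (simp add: distr_law[OF c2])
  qed
  ultimately show "\<pi> \<in> couplings \<mu> \<nu>"
    by (simp add: couplings_def)
  have "measure L {b. pair_code h1 h2 (pair_decode \<phi>1 \<phi>2 b) \<in> cyl u} = measure L (cyl u)"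
  proof (rule L.finite_measure_eq_AE)
    show "AE b in L. (b \<in> {b. pair_code h1 h2 (pair_decode \<phi>1 \<phi>2 b) \<in> cyl u}) = (b \<in> cyl u)"
      using ae by eventually_elim simp
    show "{b. pair_code h1 h2 (pair_decode \<phi>1 \<phi>2 b) \<in> cyl u} \<in> sets L" "cyl u \<in> sets L"
      using measurable_sets[OF measurable_compose[OF c(2) c(1)] sets_cyl[of u]]
      by (simp_all add: L(2) vimage_def)
  qed
  moreover have "cyl_prob (pair_code h1 h2) \<pi> u = measure L {b. pair_code h1 h2 (pair_decode \<phi>1 \<phi>2 b) \<in> cyl u}"
    unfolding cyl_prob_def to using pd sets_coding_cyl[OF c(1)] sets_eq_imp_space_eq[OF L(2)]
    by (subst measure_distr) (auto simp: vimage_def)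
  ultimately show "cyl_prob (pair_code h1 h2) \<pi> u = measure L (cyl u)" by simp
qed

text \<open>The event is decided by the first \<open>N\<close> bits. Marginal probabilities are
  thereby finite linear functions of the array of cylinder probabilities, a relation that survives
  limits.\<close>

lemma measure_reindex_cyl:
  assumes Q: "prob_space Q" "sets Q = sets cantor" and \<gamma>: "\<And>i. i < length s \<Longrightarrow> \<gamma> i < N"
  shows "measure Q {b. b \<circ> \<gamma> \<in> cyl s} =
    (\<Sum>u\<in>lists_of N. of_bool (\<forall>i<length s. u ! \<gamma> i = s ! i) * measure Q (cyl u))"
proof -
  interpret prob_space Q by fact
  have [simp]: "space Q = UNIV"
    using sets_eq_imp_space_eq[OF Q(2)] by simp
  have "{b \<in> space cantor. b \<circ> \<gamma> \<in> cyl s} \<in> sets cantor" by measurable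
  then have "measure Q {b. b \<circ> \<gamma> \<in> cyl s} = (\<integral>b. indicator {b. b \<circ> \<gamma> \<in> cyl s} b \<partial>Q)"
    by (simp add: Q(2))
  also have "\<dots> = (\<integral>b. of_bool (\<forall>i<length s. map b [0..<N] ! \<gamma> i = s ! i) \<partial>Q)"
    using \<gamma> by (intro Bochner_Integration.integral_cong) (auto simp: cyl_def indicator_def)
  also have "\<dots> = (\<Sum>u\<in>lists_of N. of_bool (\<forall>i<length s. u ! \<gamma> i = s ! i) * measure Q (cyl u))"
    using integral_finite_bits(1)[OF Q, of "\<lambda>u. of_bool (\<forall>i<length s. u ! \<gamma> i = s ! i)"] by simp
  finally show ?thesis .
qed

lemma measure_reindex_LIMSEQ:
  assumes Q: "\<And>n. prob_space (Q n)" "\<And>n. sets (Q n) = sets cantor"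
    and L: "prob_space L" "sets L = sets cantor"
    and lim: "\<And>u. (\<lambda>n. measure (Q n) (cyl u)) \<longlonglongrightarrow> measure L (cyl u)"
  shows "(\<lambda>n. measure (Q n) {b. b \<circ> \<gamma> \<in> cyl s}) \<longlonglongrightarrow> measure L {b. b \<circ> \<gamma> \<in> cyl s}"
proof -
  obtain N where "\<forall>n\<in>\<gamma> ` {..<length s}. n < N"
    using finite_nat_set_iff_bounded[of "\<gamma> ` {..<length s}"] by auto
  then have N: "i < length s \<Longrightarrow> \<gamma> i < N" for i by auto
  have "measure M {b. b \<circ> \<gamma> \<in> cyl s} =
      (\<Sum>u\<in>lists_of N. of_bool (\<forall>i<length s. u ! \<gamma> i = s ! i) * measure M (cyl u))"
    if "prob_space M" "sets M = sets cantor" for M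
    using that N by (rule measure_reindex_cyl)
  then show ?thesis
    using Q L lim by (simp only:) (intro tendsto_intros)
qed

lemma measure_reindex_law:
  assumes "h \<in> borel \<rightarrow>\<^sub>M cantor"
  shows "measure (law h \<mu>) {b. b \<circ> \<gamma> \<in> cyl s} = measure (to_measure \<mu>) {x. h x \<circ> \<gamma> \<in> cyl s}"
proof -
  have "{b \<in> space cantor. b \<circ> \<gamma> \<in> cyl s} \<in> sets cantor" by measurable
  then show ?thesis using measure_law[OF assms] by simp
qed

section \<open>Optimal transport in code\<close>

text \<open>The product measure is a coupling; second countability identifies its sigma-algebra with
  the Borel sets of the product space.\<close>

lemma couplings_nonempty:
  fixes \<mu> :: "'x::second_countable_topology borel_prob" and \<nu> :: "'y::second_countable_topology borel_prob"
  shows "couplings \<mu> \<nu> \<noteq> {}"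
proof -
  interpret M: prob_space "to_measure \<mu>" by simp
  interpret N: prob_space "to_measure \<nu>" by simp
  interpret pair_prob_space "to_measure \<mu>" "to_measure \<nu>" ..
  define \<pi> where "\<pi> = of_measure (to_measure \<mu> \<Otimes>\<^sub>M to_measure \<nu>)"
  have to: "to_measure \<pi> = to_measure \<mu> \<Otimes>\<^sub>M to_measure \<nu>"
    unfolding \<pi>_def
  proof (rule to_measure_of_measure)
    show "sets (to_measure \<mu> \<Otimes>\<^sub>M to_measure \<nu>) = sets borel"
      unfolding borel_prod[symmetric] by (rule sets_pair_measure_cong) simp_all
  qed (rule prob_space_axioms)
  have [measurable]: "fst \<in> to_measure \<mu> \<Otimes>\<^sub>M to_measure \<nu> \<rightarrow>\<^sub>M borel" "snd \<in> to_measure \<mu> \<Otimes>\<^sub>M to_measure \<nu> \<rightarrow>\<^sub>M borel"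
    by measurable
  have "pushforward fst \<pi> = \<mu>"
  proof (rule borel_prob_eqI, unfold to_measure_pushforward[OF borel_measurable_fst_snd(1)] to, rule measure_eqI)
    fix A assume "A \<in> sets (distr (to_measure \<mu> \<Otimes>\<^sub>M to_measure \<nu>) borel fst)"
    then have A: "A \<in> sets borel" by simp
    have "emeasure (distr (to_measure \<mu> \<Otimes>\<^sub>M to_measure \<nu>) borel fst) A =
        emeasure (to_measure \<mu> \<Otimes>\<^sub>M to_measure \<nu>) (A \<times> UNIV)"
      using A by (subst emeasure_distr) (auto simp: space_pair_measure intro!: arg_cong2[where f = emeasure])
    also have "\<dots> = emeasure (to_measure \<mu>) A"
      using A N.emeasure_space_1 by (subst N.emeasure_pair_measure_Times) auto
    finally show "emeasure (distr (to_measure \<mu> \<Otimes>\<^sub>M to_measure \<nu>) borel fst) A = emeasure (to_measure \<mu>) A" .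
  qed simp
  moreover have "pushforward snd \<pi> = \<nu>"
  proof (rule borel_prob_eqI, unfold to_measure_pushforward[OF borel_measurable_fst_snd(2)] to, rule measure_eqI)
    fix A assume "A \<in> sets (distr (to_measure \<mu> \<Otimes>\<^sub>M to_measure \<nu>) borel snd)"
    then have A: "A \<in> sets borel" by simp
    have "emeasure (distr (to_measure \<mu> \<Otimes>\<^sub>M to_measure \<nu>) borel snd) A =
        emeasure (to_measure \<mu> \<Otimes>\<^sub>M to_measure \<nu>) (UNIV \<times> A)"
      using A by (subst emeasure_distr) (auto simp: space_pair_measure intro!: arg_cong2[where f = emeasure])
    also have "\<dots> = emeasure (to_measure \<nu>) A"
      using A M.emeasure_space_1 by (subst N.emeasure_pair_measure_Times) auto
    finally show "emeasure (distr (to_measure \<mu> \<Otimes>\<^sub>M to_measure \<nu>) borel snd) A = emeasure (to_measure \<nu>) A" .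
  qed simp
  ultimately show ?thesis by (auto simp: couplings_def)
qed

text \<open>The ground codes are base codes rather than arbitrary codings: agreement of finitely
  many bits must place a point in a prescribed neighbourhood, so that prefixes detect lower
  semicontinuity.\<close>

locale coded_cost =
  fixes c :: "'a::polish_space \<times> 'b::polish_space \<Rightarrow> ennreal"
    and U :: "nat \<Rightarrow> 'a set" and V :: "nat \<Rightarrow> 'b set"
    and \<phi>1 :: "(nat \<Rightarrow> bool) \<Rightarrow> 'a" and \<phi>2 :: "(nat \<Rightarrow> bool) \<Rightarrow> 'b"
  assumes lsc: "lower_semicontinuous c"
    and basis: "topological_basis (range U)" "topological_basis (range V)"
    and base_coding: "coding (base_code U) \<phi>1" "coding (base_code V) \<phi>2"
begin

abbreviation "h1 \<equiv> base_code U"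
abbreviation "h2 \<equiv> base_code V"
abbreviation "h \<equiv> pair_code h1 h2"
abbreviation "\<phi> \<equiv> pair_decode \<phi>1 \<phi>2"

lemmas coding_h = coding_pair[OF base_coding]

text \<open>The truncation keeps the value finite where \<open>c\<close> is infinite and on cylinders without points.\<close>

definition cost_below :: "nat \<Rightarrow> bool list \<Rightarrow> ennreal" where
  "cost_below n u = min (of_nat n) (INF w\<in>{w. h w \<in> cyl u}. c w)"

lemma cost_below_le: "cost_below n (map (h w) [0..<n]) \<le> c w"
  unfolding cost_below_def by (intro min.coboundedI2 INF_lower) (simp add: mem_cyl_iff)

lemma incseq_cost_below: "incseq (\<lambda>n. cost_below n (map b [0..<n]))"
proof (rule incseq_SucI)
  fix n
  have "{w. h w \<in> cyl (map b [0..<Suc n])} \<subseteq> {w. h w \<in> cyl (map b [0..<n])}"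
    by (auto simp: cyl_def nth_append less_Suc_eq)
  then show "cost_below n (map b [0..<n]) \<le> cost_below (Suc n) (map b [0..<Suc n])"
    unfolding cost_below_def by (intro min.mono INF_superset_mono) (auto simp del: upt_Suc)
qed

text \<open>If \<open>t < c w\<close>, then \<open>c\<close> exceeds \<open>t\<close> on a product
  of base sets around \<open>w\<close>, and membership in this product is decided by two bits of the
  code.\<close>

lemma SUP_cost_below: "(SUP n. cost_below n (map (h w) [0..<n])) = c w"
proof (rule antisym)
  show "(SUP n. cost_below n (map (h w) [0..<n])) \<le> c w"
    by (intro SUP_least cost_below_le)
  show "c w \<le> (SUP n. cost_below n (map (h w) [0..<n]))"
  proof (rule dense_le)
    fix t assume t: "t < c w"
    then have "\<forall>\<^sub>F w' in nhds w. t < c w'"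
      using lsc unfolding lower_semicontinuous_def by blast
    then obtain S where S: "open S" "w \<in> S" "\<And>w'. w' \<in> S \<Longrightarrow> t < c w'"
      by (auto simp: eventually_nhds)
    then obtain A B where AB: "open A" "open B" "w \<in> A \<times> B" "A \<times> B \<subseteq> S"
      by (auto elim: open_prod_elim)
    obtain i where i: "fst w \<in> U i" "U i \<subseteq> A"
      using topological_basisE[OF basis(1) AB(1), of "fst w"] AB(3) by (metis SigmaE fst_conv rangeE)
    obtain j where j: "snd w \<in> V j" "V j \<subseteq> B"
      using topological_basisE[OF basis(2) AB(2), of "snd w"] AB(3) by (metis SigmaE snd_conv rangeE)
    obtain k where k: "t < of_nat k"
      using t ennreal_Ex_less_of_nat[of t] less_top_ennreal by (metis order_less_le_trans top_greatest)
    \<comment> \<open>Long enough to contain the interleaved positions \<open>2 * i\<close> and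
      \<open>Suc (2 * j)\<close>, and at least \<open>k\<close> so that the truncation does not fall
      below \<open>t\<close>.\<close>
    define n where "n = k + 2 * i + 2 * j + 2"
    have "t \<le> c w'" if "h w' \<in> cyl (map (h w) [0..<n])" for w'
    proof -
      have "h w' l = h w l" if "l < n" for l
        using \<open>h w' \<in> _\<close> that by (auto simp: cyl_def)
      from this[of "2 * i"] this[of "Suc (2 * j)"]
      have "fst w' \<in> U i" "snd w' \<in> V j"
        using i j by (auto simp: n_def pair_code_def base_code_def)
      then have "w' \<in> S"
        using AB(4) i j by (cases w') auto
      then show ?thesis
        by (intro less_imp_le S(3))
    qed
    moreover have "t \<le> of_nat n"
      using k by (auto simp: n_def intro: order_trans[OF less_imp_le])
    ultimately have "t \<le> cost_below n (map (h w) [0..<n])"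
      unfolding cost_below_def by (auto intro: INF_greatest)
    then show "t \<le> (SUP n. cost_below n (map (h w) [0..<n]))"
      by (rule SUP_upper2[OF UNIV_I])
  qed
qed

text \<open>Being linear and defined for arbitrary arrays, it can be applied to arrays read from
  limiting bits, where it is a tame function of the bits.\<close>

definition array_cost :: "nat \<Rightarrow> (bool list \<Rightarrow> real) \<Rightarrow> real" where
  "array_cost n z = (\<Sum>u\<in>lists_of n. enn2real (cost_below n u) * z u)"

lemma ennreal_enn2real_cost_below: "ennreal (enn2real (cost_below n u)) = cost_below n u"
  by (rule ennreal_enn2real) (auto simp: cost_below_def min_less_iff_disj ennreal_of_nat_eq_real_of_nat)

lemma nn_integral_cost_below:
  shows "(\<integral>\<^sup>+w. cost_below n (map (h w) [0..<n]) \<partial>to_measure \<pi>) = ennreal (array_cost n (cyl_prob h \<pi>))"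
    and "(\<lambda>w. cost_below n (map (h w) [0..<n])) \<in> borel_measurable (to_measure \<pi>)"
proof -
  interpret prob_space "to_measure \<pi>" by simp
  have cyl: "{w. h w \<in> cyl u} \<in> sets (to_measure \<pi>)" for u
    using sets_coding_cyl[OF codingD(1)[OF coding_h], of u] by simp
  have eq: "cost_below n (map (h w) [0..<n]) = (\<Sum>u\<in>lists_of n. cost_below n u * indicator {w. h w \<in> cyl u} w)" for w
    by (subst sum_indicator_cyl[symmetric]) (auto intro!: sum.cong simp: indicator_def)
  show "(\<lambda>w. cost_below n (map (h w) [0..<n])) \<in> borel_measurable (to_measure \<pi>)"
    unfolding eq using cyl by (intro borel_measurable_sum borel_measurable_times_ennreal) auto
  have "(\<integral>\<^sup>+w. cost_below n (map (h w) [0..<n]) \<partial>to_measure \<pi>) =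
      (\<Sum>u\<in>lists_of n. cost_below n u * ennreal (cyl_prob h \<pi> u))"
    unfolding eq using cyl
    by (subst nn_integral_sum) (auto simp: nn_integral_cmult_indicator cyl_prob_def emeasure_eq_measure)
  also have "\<dots> = (\<Sum>u\<in>lists_of n. ennreal (enn2real (cost_below n u) * cyl_prob h \<pi> u))"
    by (intro sum.cong) (auto simp: ennreal_mult cyl_prob_01 ennreal_enn2real_cost_below)
  also have "\<dots> = ennreal (array_cost n (cyl_prob h \<pi>))"
    unfolding array_cost_def by (rule sum_ennreal) (simp add: cyl_prob_01)
  finally show "(\<integral>\<^sup>+w. cost_below n (map (h w) [0..<n]) \<partial>to_measure \<pi>) = ennreal (array_cost n (cyl_prob h \<pi>))" .
qed

lemma incseq_array_cost: "incseq (\<lambda>n. ennreal (array_cost n (cyl_prob h \<pi>)))"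
  unfolding nn_integral_cost_below(1)[symmetric] using incseq_cost_below
  by (auto simp: incseq_def intro!: nn_integral_mono)

text \<open>Monotone convergence turns the cost into a supremum of finite linear functions of the
  cylinder probabilities; lower semicontinuity along cylinder convergence comes from this
  form.\<close>

lemma plan_cost_eq_SUP: "plan_cost c \<pi> = (SUP n. ennreal (array_cost n (cyl_prob h \<pi>)))"
proof -
  have "plan_cost c \<pi> = (\<integral>\<^sup>+w. (SUP n. cost_below n (map (h w) [0..<n])) \<partial>to_measure \<pi>)"
    by (simp add: SUP_cost_below)
  also have "\<dots> = (SUP n. \<integral>\<^sup>+w. cost_below n (map (h w) [0..<n]) \<partial>to_measure \<pi>)"
    using incseq_cost_below
    by (intro nn_integral_monotone_convergence_SUP nn_integral_cost_below(2)) (auto simp: incseq_def le_fun_def)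
  finally show ?thesis
    by (simp add: nn_integral_cost_below(1))
qed

lemma borel_measurable_array_cost:
  "(\<lambda>\<pi>. ennreal (array_cost n (cyl_prob h \<pi>))) \<in> borel_measurable borel"
  unfolding array_cost_def
  by (intro measurable_compose[OF _ measurable_ennreal] borel_measurable_sum borel_measurable_times
      borel_measurable_const measurable_cyl_prob codingD(1)[OF coding_h])

lemma random_plan_cost_eq_SUP:
  "random_plan_cost c P = (SUP n. \<integral>\<^sup>+\<pi>. ennreal (array_cost n (cyl_prob h \<pi>)) \<partial>to_measure P)"
  unfolding plan_cost_eq_SUP
proof (rule nn_integral_monotone_convergence_SUP)
  show "incseq (\<lambda>n \<pi>. ennreal (array_cost n (cyl_prob h \<pi>)))"
    using incseq_array_cost by (auto simp: incseq_def le_fun_def)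
  show "(\<lambda>\<pi>. ennreal (array_cost n (cyl_prob h \<pi>))) \<in> borel_measurable (to_measure P)" for n
    unfolding measurable_to_measure_iff by (rule borel_measurable_array_cost)
qed

lemma array_cost_le_plan_cost: "ennreal (array_cost n (cyl_prob h \<pi>)) \<le> plan_cost c \<pi>"
  unfolding plan_cost_eq_SUP by (rule SUP_upper) simp

lemma plan_cost_le_limit:
  assumes lim: "\<And>u. (\<lambda>k. cyl_prob h (\<pi>' k) u) \<longlonglongrightarrow> cyl_prob h \<pi> u"
    and le: "\<And>k. plan_cost c (\<pi>' k) \<le> t k" and t: "t \<longlonglongrightarrow> t0"
  shows "plan_cost c \<pi> \<le> t0"
  unfolding plan_cost_eq_SUP
proof (rule SUP_least)
  fix n
  have "(\<lambda>k. ennreal (array_cost n (cyl_prob h (\<pi>' k)))) \<longlonglongrightarrow> ennreal (array_cost n (cyl_prob h \<pi>))"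
    unfolding array_cost_def by (intro tendsto_intros tendsto_ennrealI lim)
  then show "ennreal (array_cost n (cyl_prob h \<pi>)) \<le> t0"
    using t order_trans[OF array_cost_le_plan_cost le] by (intro LIMSEQ_le) auto
qed

text \<open>Compactness gives a limit law on pairs of codes. Its halves have the laws of the codes
  of \<mu> and \<nu>, so gluing turns it into a plan.\<close>

lemma couplings_limit:
  assumes lim1: "\<And>s. (\<lambda>k. cyl_prob h1 (pushforward fst (\<pi>' k)) s) \<longlonglongrightarrow> cyl_prob h1 \<mu> s"
    and lim2: "\<And>s. (\<lambda>k. cyl_prob h2 (pushforward snd (\<pi>' k)) s) \<longlonglongrightarrow> cyl_prob h2 \<nu> s"
  obtains r \<pi> where "strict_mono (r :: nat \<Rightarrow> nat)" "\<pi> \<in> couplings \<mu> \<nu>"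
    "\<And>u. (\<lambda>k. cyl_prob h (\<pi>' (r k)) u) \<longlonglongrightarrow> cyl_prob h \<pi> u"
proof -
  have Q: "prob_space (law h (\<pi>' k))" "sets (law h (\<pi>' k)) = sets cantor" for k
    using prob_space_law[OF codingD(1)[OF coding_h]] by auto
  obtain r L where r: "strict_mono (r :: nat \<Rightarrow> nat)" and L: "prob_space L" "sets L = sets cantor"
    and lim: "\<And>u. (\<lambda>k. measure (law h (\<pi>' (r k))) (cyl u)) \<longlonglongrightarrow> measure L (cyl u)"
    using cantor_prob_compact[of "\<lambda>k. law h (\<pi>' k)"] Q by metis
  have m1: "measure L {b. b \<circ> (\<lambda>i. 2 * i) \<in> cyl s} = cyl_prob h1 \<mu> s" for s
  proof (rule LIMSEQ_unique[OF measure_reindex_LIMSEQ[OF Q L lim]])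
    have "(\<lambda>k. cyl_prob h1 (pushforward fst (\<pi>' (r k))) s) \<longlonglongrightarrow> cyl_prob h1 \<mu> s"
      using LIMSEQ_subseq_LIMSEQ[OF lim1 r] by (simp add: comp_def)
    then show "(\<lambda>k. measure (law h (\<pi>' (r k))) {b. b \<circ> (\<lambda>i. 2 * i) \<in> cyl s}) \<longlonglongrightarrow> cyl_prob h1 \<mu> s"
      by (subst (asm) cyl_prob_marginal[where h = h])
        (auto simp: codingD[OF base_coding(1)] codingD[OF coding_h] borel_measurable_fst_snd pair_code_comp)
  qed
  have m2: "measure L {b. b \<circ> (\<lambda>i. Suc (2 * i)) \<in> cyl s} = cyl_prob h2 \<nu> s" for s
  proof (rule LIMSEQ_unique[OF measure_reindex_LIMSEQ[OF Q L lim]])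
    have "(\<lambda>k. cyl_prob h2 (pushforward snd (\<pi>' (r k))) s) \<longlonglongrightarrow> cyl_prob h2 \<nu> s"
      using LIMSEQ_subseq_LIMSEQ[OF lim2 r] by (simp add: comp_def)
    then show "(\<lambda>k. measure (law h (\<pi>' (r k))) {b. b \<circ> (\<lambda>i. Suc (2 * i)) \<in> cyl s}) \<longlonglongrightarrow> cyl_prob h2 \<nu> s"
      by (subst (asm) cyl_prob_marginal[where h = h])
        (auto simp: codingD[OF base_coding(2)] codingD[OF coding_h] borel_measurable_fst_snd pair_code_comp)
  qed
  note g = glue_couplings[OF base_coding L m1 m2]
  show ?thesis
    using that[OF r g(1)] lim unfolding g(2) by (simp add: measure_law_cyl codingD[OF coding_h])
qed

text \<open>A sublevel set \<open>S\<close> is closed for convergence of the cylinder probabilities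
  of both measures: it is the preimage under \<open>E\<close> of the closure of its image.
  Measurability of \<open>E\<close> then suffices.\<close>

lemma borel_measurable_ot_cost:
  "(\<lambda>m. ot_cost c (fst m) (snd m)) \<in> borel_measurable borel"
proof (rule borel_measurableI_le)
  fix t :: ennreal
  define E where "E m = (cyl_prob h1 (fst m), cyl_prob h2 (snd m))" for m
  have E: "E \<in> borel_measurable borel"
    unfolding E_def
    by (intro borel_measurable_Pair measurable_coordinatewise_then_product
        measurable_compose[OF borel_measurable_fst_snd(1) measurable_cyl_prob]
        measurable_compose[OF borel_measurable_fst_snd(2) measurable_cyl_prob]
        codingD(1)[OF base_coding(1)] codingD(1)[OF base_coding(2)])
  define S where "S = {m. ot_cost c (fst m) (snd m) \<le> t}"
  have "S \<in> sets borel"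
  \<comment> \<open>Nearly optimal plans are chosen below by a strict inequality, which requires a
    finite \<open>t\<close>.\<close>
  proof (cases "t = \<top>")
    case True
    then show ?thesis by (simp add: S_def)
  next
    case False
    have *: "m \<in> S" if m: "E m \<in> closure (E ` S)" for m
    proof -
      obtain x where x: "\<And>k. x k \<in> E ` S" "x \<longlonglongrightarrow> E m"
        using m unfolding closure_sequential by blast
      then have "\<forall>k. \<exists>m'\<in>S. x k = E m'" by blast
      then obtain m' where m': "\<And>k. m' k \<in> S" "\<And>k. x k = E (m' k)"
        by metis
      have "\<exists>\<pi>\<in>couplings (fst (m' k)) (snd (m' k)). plan_cost c \<pi> < t + ennreal (1 / real (Suc k))" for k
      proof -
        have "ot_cost c (fst (m' k)) (snd (m' k)) < t + ennreal (1 / real (Suc k))"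
          using m'(1)[of k] False ennreal_add_left_cancel_less[of t 0 "ennreal (1 / real (Suc k))"]
          by (auto simp: S_def simp del: of_nat_Suc ennreal_add_left_cancel_less intro: le_less_trans)
        then show ?thesis
          unfolding ot_cost_def INF_less_iff .
      qed
      then obtain \<pi>' where \<pi>': "\<And>k. \<pi>' k \<in> couplings (fst (m' k)) (snd (m' k))"
        "\<And>k. plan_cost c (\<pi>' k) < t + ennreal (1 / real (Suc k))"
        by metis
      have "(\<lambda>k. fst (x k)) \<longlonglongrightarrow> cyl_prob h1 (fst m)" "(\<lambda>k. snd (x k)) \<longlonglongrightarrow> cyl_prob h2 (snd m)"
        using tendsto_fst[OF x(2)] tendsto_snd[OF x(2)] by (simp_all add: E_def)
      from continuous_on_tendsto_compose[OF continuous_on_product_coordinates this(1)]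
        continuous_on_tendsto_compose[OF continuous_on_product_coordinates this(2)]
      have "(\<lambda>k. cyl_prob h1 (pushforward fst (\<pi>' k)) s) \<longlonglongrightarrow> cyl_prob h1 (fst m) s"
        "(\<lambda>k. cyl_prob h2 (pushforward snd (\<pi>' k)) s) \<longlonglongrightarrow> cyl_prob h2 (snd m) s" for s
        using \<pi>'(1) by (simp_all add: m' E_def couplings_def)
      then obtain r \<pi> where r: "strict_mono (r :: nat \<Rightarrow> nat)" "\<pi> \<in> couplings (fst m) (snd m)"
        "\<And>u. (\<lambda>k. cyl_prob h (\<pi>' (r k)) u) \<longlonglongrightarrow> cyl_prob h \<pi> u"
        using couplings_limit by blast
      have "(\<lambda>k. 1 / real (Suc k)) \<longlonglongrightarrow> 0"
        using LIMSEQ_inverse_real_of_nat by (simp add: inverse_eq_divide)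
      from LIMSEQ_subseq_LIMSEQ[OF this r(1)]
      have "(\<lambda>k. t + ennreal (1 / real (Suc (r k)))) \<longlonglongrightarrow> t + ennreal 0"
        unfolding comp_def by (intro tendsto_intros tendsto_ennrealI)
      then have "plan_cost c \<pi> \<le> t + ennreal 0"
        by (rule plan_cost_le_limit[OF r(3) less_imp_le[OF \<pi>'(2)]])
      then show "m \<in> S"
        unfolding S_def ot_cost_def using r(2) by (auto intro: INF_lower2)
    qed
    have "S = E -` closure (E ` S) \<inter> space borel"
    proof (intro equalityI subsetI)
      fix m assume "m \<in> S"
      then have "E m \<in> closure (E ` S)"
        by (intro subsetD[OF closure_subset] imageI)
      then show "m \<in> E -` closure (E ` S) \<inter> space borel" by simp
    next
      fix m assume "m \<in> E -` closure (E ` S) \<inter> space borel"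
      then show "m \<in> S" by (intro *) simp
    qed
    then show ?thesis
      using measurable_sets[OF E, of "closure (E ` S)"] by simp
  qed
  then show "{m \<in> space borel. ot_cost c (fst m) (snd m) \<le> t} \<in> sets borel"
    by (simp add: S_def)
qed

end

section \<open>Random couplings\<close>

lemma borel_measurable_marginals:
  "marginals \<in> borel_measurable borel"
  by (rule borel_measurable_continuous_onI[OF continuous_on_marginals])

lemma borel_measurable_pushforward:
  "continuous_on UNIV f \<Longrightarrow> pushforward f \<in> borel_measurable borel"
  by (intro borel_measurable_continuous_onI continuous_on_pushforward)

lemma borel_measurable_pushforward_fst_snd:
  "pushforward fst \<in> borel_measurable (borel :: ('a::topological_space \<times> 'b::topological_space) borel_prob measure)"
  "pushforward snd \<in> borel_measurable (borel :: ('a::topological_space \<times> 'b::topological_space) borel_prob measure)"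
  by (intro borel_measurable_pushforward continuous_intros)+

lemma pushforward_pushforward:
  assumes "f \<in> borel_measurable borel" "g \<in> borel_measurable borel"
  shows "pushforward g (pushforward f \<mu>) = pushforward (\<lambda>x. g (f x)) \<mu>"
  using assms measurable_compose[OF assms]
  by (intro borel_prob_eqI) (simp add: to_measure_pushforward distr_distr measurable_to_measure_iff comp_def)

lemma pushforward_marginals_in_couplings:
  assumes "P \<in> random_couplings M1 M2"
  shows "pushforward marginals P \<in> couplings M1 M2"
  using assms
  by (simp add: couplings_def random_couplings_def pushforward_pushforward borel_measurable_marginals
      borel_measurable_fst_snd marginals_def)

context coded_cost
begin

lemma borel_measurable_cost: "c \<in> borel_measurable borel"
proof (rule borel_measurableI_greater)
  fix t
  have "open {w. t < c w}"
    unfolding open_subopen[of "{w. t < c w}"]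
  proof
    fix w assume "w \<in> {w. t < c w}"
    then have "\<forall>\<^sub>F w' in nhds w. t < c w'"
      using lsc unfolding lower_semicontinuous_def by blast
    then show "\<exists>T. open T \<and> w \<in> T \<and> T \<subseteq> {w. t < c w}"
      by (auto simp: eventually_nhds)
  qed
  then show "{w \<in> space borel. t < c w} \<in> sets borel" by simp
qed

lemma borel_measurable_plan_cost: "plan_cost c \<in> borel_measurable borel"
  using measurable_compose[OF measurable_prob_algebraD[OF measurable_to_measure]
      nn_integral_measurable_subprob_algebra[OF borel_measurable_cost]] .

definition "g1 = prob_code h1"
definition "g2 = prob_code h2"
definition "\<psi>1 = prob_decode \<phi>1"
definition "\<psi>2 = prob_decode \<phi>2"

lemma coding_g: "coding g1 \<psi>1" "coding g2 \<psi>2" "coding (prob_code h) (prob_decode \<phi>)"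
  unfolding g1_def g2_def \<psi>1_def \<psi>2_def by (intro coding_prob base_coding coding_h)+

text \<open>To discretise a coupling of laws, replace each pair of measures by the marginals of a nearly
  optimal plan among those whose marginals have the same first \<open>n\<close> code bits.\<close>

definition code_prefix :: "nat \<Rightarrow> 'a borel_prob \<times> 'b borel_prob \<Rightarrow> bool list \<times> bool list" where
  "code_prefix n m = (map (g1 (fst m)) [0..<n], map (g2 (snd m)) [0..<n])"

definition near_optimal :: "nat \<Rightarrow> bool list \<times> bool list \<Rightarrow> ('a \<times> 'b) borel_prob" where
  "near_optimal n k = (SOME \<pi>. code_prefix n (marginals \<pi>) = k \<and>
     (\<forall>\<pi>'. code_prefix n (marginals \<pi>') = k \<longrightarrow> plan_cost c \<pi> \<le> plan_cost c \<pi>' + ennreal (1 / real (Suc n))))"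

definition discretise :: "nat \<Rightarrow> 'a borel_prob \<times> 'b borel_prob \<Rightarrow> ('a \<times> 'b) borel_prob" where
  "discretise n m = near_optimal n (code_prefix n m)"

text \<open>Each coupling of the two measures in \<open>m\<close> competes in the class of plans
  with the same prefix, so the infimum over the class is at most the transport cost; the tolerance
  disappears as \<open>n\<close> grows.\<close>

lemma discretise:
  shows "code_prefix n (marginals (discretise n m)) = code_prefix n m"
    and "plan_cost c (discretise n m) \<le> ot_cost c (fst m) (snd m) + ennreal (1 / real (Suc n))"
proof -
  define A where "A = {\<pi>. code_prefix n (marginals \<pi>) = code_prefix n m}"
  obtain \<pi>0 where "\<pi>0 \<in> couplings (fst m) (snd m)"
    using couplings_nonempty by blast
  then have "\<pi>0 \<in> A"
    by (simp add: A_def couplings_def marginals_def)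
  have "\<exists>\<pi>\<in>A. \<forall>\<pi>'\<in>A. plan_cost c \<pi> \<le> plan_cost c \<pi>' + ennreal (1 / real (Suc n))"
  \<comment> \<open>With an infinite infimum no plan lies strictly below infimum plus tolerance, but
    then all competitors cost infinity and any of them will do.\<close>
  proof (cases "(INF \<pi>\<in>A. plan_cost c \<pi>) = \<top>")
    case True
    then have "plan_cost c \<pi>' = \<top>" if "\<pi>' \<in> A" for \<pi>'
      using INF_lower[OF that, of "plan_cost c"] by (simp add: top_unique)
    then show ?thesis
      using \<open>\<pi>0 \<in> A\<close> by (intro bexI[of _ \<pi>0]) auto
  next
    case False
    then have "(INF \<pi>\<in>A. plan_cost c \<pi>) < (INF \<pi>\<in>A. plan_cost c \<pi>) + ennreal (1 / real (Suc n))"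
      using ennreal_add_left_cancel_less[of "INF \<pi>\<in>A. plan_cost c \<pi>" 0 "ennreal (1 / real (Suc n))"]
      by (simp del: ennreal_add_left_cancel_less)
    then obtain \<pi> where "\<pi> \<in> A" "plan_cost c \<pi> < (INF \<pi>\<in>A. plan_cost c \<pi>) + ennreal (1 / real (Suc n))"
      by (subst (asm) (1) INF_less_iff) blast
    moreover have "(INF \<pi>\<in>A. plan_cost c \<pi>) + ennreal (1 / real (Suc n)) \<le> plan_cost c \<pi>' + ennreal (1 / real (Suc n))"
      if "\<pi>' \<in> A" for \<pi>'
      using that by (intro add_right_mono INF_lower)
    ultimately show ?thesis
      by (intro bexI[of _ \<pi>] ballI) (rule order_trans[OF less_imp_le])
  qed
  then have ex: "\<exists>\<pi>. code_prefix n (marginals \<pi>) = code_prefix n m \<and> (\<forall>\<pi>'.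
      code_prefix n (marginals \<pi>') = code_prefix n m \<longrightarrow> plan_cost c \<pi> \<le> plan_cost c \<pi>' + ennreal (1 / real (Suc n)))"
    by (simp add: A_def)
  have *: "discretise n m \<in> A \<and>
      (\<forall>\<pi>'\<in>A. plan_cost c (discretise n m) \<le> plan_cost c \<pi>' + ennreal (1 / real (Suc n)))"
    using someI_ex[OF ex] unfolding discretise_def near_optimal_def A_def by simp
  then show "code_prefix n (marginals (discretise n m)) = code_prefix n m"
    by (simp add: A_def)
  have "plan_cost c (discretise n m) - ennreal (1 / real (Suc n)) \<le> plan_cost c \<pi>'"
    if "\<pi>' \<in> couplings (fst m) (snd m)" for \<pi>'
  proof -
    have "marginals \<pi>' = m"
      using that by (simp add: couplings_def marginals_def)
    then show ?thesis
      using * unfolding ennreal_minus_le_iff by (auto simp: A_def add.commute)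
  qed
  then have "plan_cost c (discretise n m) - ennreal (1 / real (Suc n)) \<le> ot_cost c (fst m) (snd m)"
    unfolding ot_cost_def by (rule INF_greatest)
  then show "plan_cost c (discretise n m) \<le> ot_cost c (fst m) (snd m) + ennreal (1 / real (Suc n))"
    unfolding ennreal_minus_le_iff by (simp add: add.commute)
qed

text \<open>The map factors through the prefix, which lives in a countable discrete space; whatever
  \<open>near_optimal\<close> chooses, measurability of the prefix is enough.\<close>

lemma borel_measurable_discretise: "discretise n \<in> borel_measurable borel"
proof -
  have "code_prefix n \<in> borel \<rightarrow>\<^sub>M count_space UNIV"
    unfolding measurable_count_space_eq2_countable
  proof (intro conjI ballI)
    fix k :: "bool list \<times> bool list"
    have 1: "fst -` {\<mu>. g1 \<mu> \<in> cyl (fst k)} \<inter> space borel \<in> sets (borel :: ('a borel_prob \<times> 'b borel_prob) measure)"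
      using borel_measurable_fst_snd(1) sets_coding_cyl[OF codingD(1)[OF coding_g(1)]] by (rule measurable_sets)
    have 2: "snd -` {\<nu>. g2 \<nu> \<in> cyl (snd k)} \<inter> space borel \<in> sets (borel :: ('a borel_prob \<times> 'b borel_prob) measure)"
      using borel_measurable_fst_snd(2) sets_coding_cyl[OF codingD(1)[OF coding_g(2)]] by (rule measurable_sets)
    show "code_prefix n -` {k} \<inter> space borel \<in> sets borel"
    proof (cases "length (fst k) = n \<and> length (snd k) = n")
      case True
      then have "code_prefix n -` {k} \<inter> space borel =
          (fst -` {\<mu>. g1 \<mu> \<in> cyl (fst k)} \<inter> space borel) \<inter> (snd -` {\<nu>. g2 \<nu> \<in> cyl (snd k)} \<inter> space borel)"
        by (auto simp: code_prefix_def mem_cyl_iff prod_eq_iff)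
      then show ?thesis
        using sets.Int[OF 1 2] by simp
    next
      case False
      then have "code_prefix n -` {k} \<inter> space borel = {}"
        by (auto simp: code_prefix_def)
      then show ?thesis by simp
    qed
  qed auto
  then show ?thesis
    unfolding discretise_def by (rule measurable_compose) simp
qed

text \<open>The marginals are recorded next to the plan, although it determines them: their codes keep
  the prescribed laws exactly, whereas binary digits are not compatible with the sums that
  express cylinder probabilities of marginals through those of the plan.\<close>

definition g :: "('a \<times> 'b) borel_prob \<Rightarrow> nat \<Rightarrow> bool" where
  "g \<pi> = pair_code (prob_code h) (pair_code g1 g2) (\<pi>, marginals \<pi>)"

abbreviation "even_bits \<equiv> (\<lambda>i::nat. 2 * i)"
text \<open>Positions 1 and 3 modulo 4: the odd half of the outer interleaving is itself an
  interleaving of the two marginal codes.\<close>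

abbreviation "fst_bits \<equiv> (\<lambda>i::nat. Suc (2 * (2 * i)))"
abbreviation "snd_bits \<equiv> (\<lambda>i::nat. Suc (2 * Suc (2 * i)))"

lemma g_comp:
  "g \<pi> \<circ> even_bits = prob_code h \<pi>"
  "g \<pi> \<circ> fst_bits = g1 (pushforward fst \<pi>)"
  "g \<pi> \<circ> snd_bits = g2 (pushforward snd \<pi>)"
  by (auto simp: g_def pair_code_def marginals_def fun_eq_iff)

lemma measurable_g: "g \<in> borel \<rightarrow>\<^sub>M cantor"
proof -
  have "(\<lambda>\<pi>. (\<pi>, marginals \<pi>)) \<in> borel \<rightarrow>\<^sub>M (borel :: (('a \<times> 'b) borel_prob \<times> _) measure)"
    using borel_measurable_marginals by (intro borel_measurable_Pair) auto
  then show ?thesis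
    unfolding g_def
    by (rule measurable_compose) (rule codingD(1)[OF coding_pair[OF coding_g(3) coding_pair[OF coding_g(1,2)]]])
qed

text \<open>The integral of \<open>\<bar>f b - f' b\<bar>\<close> vanishes under every law of codes
  and is continuous along the limit. An identity valid on codes thus holds at almost every limiting
  bit sequence, although that sequence need not be a code.\<close>

lemma limit_tame_eq:
  assumes L: "prob_space L" "sets L = sets cantor"
    and lim: "\<And>u. (\<lambda>n. measure (law g (P n)) (cyl u)) \<longlonglongrightarrow> measure L (cyl u)"
    and f: "tame f" "tame f'" and eq: "\<And>\<pi>. f (g \<pi>) = f' (g \<pi>)"
  shows "AE b in L. f b = f' b"
proof -
  note Q = prob_space_law[OF measurable_g] sets_law
  have t: "tame (\<lambda>b. \<bar>f b - f' b\<bar>)"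
    by (intro tame_abs tame_diff f)
  have "(\<integral>b. \<bar>f b - f' b\<bar> \<partial>law g (P n)) = 0" for n
    unfolding law_def using measurable_g tame_measurable[OF t]
    by (subst integral_distr) (auto simp: measurable_to_measure_iff eq)
  then have "(\<integral>b. \<bar>f b - f' b\<bar> \<partial>L) = 0"
    using LIMSEQ_unique[OF tame_integral_LIMSEQ[OF Q L lim t], of 0] by simp
  then have "AE b in L. \<bar>f b - f' b\<bar> = 0"
    using integral_nonneg_eq_0_iff_AE[OF tame_integrable[OF t L]] by simp
  then show ?thesis by simp
qed

text \<open>Two mechanisms combine. The laws of the marginal bits become exact on each fixed prefix,
  so the limiting marginal bits are codes almost everywhere. The plan bits need not be a code, yet
  the array read from them is consistent and has the marginals named by the other bits, these being
  identities of tame functions. Almost every bit sequence therefore yields a coupling of the two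
  decoded marginals.\<close>

lemma ex_random_coupling_le:
  assumes R: "\<And>n. R n \<in> couplings M1 M2"
    and le: "\<And>n. (\<integral>\<^sup>+m. ot_cost c (fst m) (snd m) \<partial>to_measure (R n)) \<le> t n" and t: "t \<longlonglongrightarrow> t0"
  shows "\<exists>P\<in>random_couplings M1 M2. random_plan_cost c P \<le> t0"
proof -
  define P' where "P' n = pushforward (discretise n) (R n)" for n
  note Q = prob_space_law[OF measurable_g] sets_law
  obtain r L where r: "strict_mono (r :: nat \<Rightarrow> nat)" and L: "prob_space L" "sets L = sets cantor"
    and lim: "\<And>u. (\<lambda>k. measure (law g (P' (r k))) (cyl u)) \<longlonglongrightarrow> measure L (cyl u)"
    using cantor_prob_compact[of "\<lambda>k. law g (P' k)"] Q by metis
  interpret L: prob_space L by fact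
  have mL: "measurable L N = measurable cantor N" for N :: "'z measure"
    using L(2) by (rule measurable_cong_sets) simp
  have law_P': "measure (law g (P' n)) {b. b \<circ> \<gamma> \<in> cyl s} =
      measure (to_measure (R n)) {m. g (discretise n m) \<circ> \<gamma> \<in> cyl s}" for n \<gamma> s
  proof -
    have "{b \<in> space cantor. b \<circ> \<gamma> \<in> cyl s} \<in> sets cantor" by measurable
    then have "{\<pi>. g \<pi> \<circ> \<gamma> \<in> cyl s} \<in> sets borel"
      using measurable_sets[OF measurable_g, of "{b. b \<circ> \<gamma> \<in> cyl s}"] by (simp add: vimage_def)
    then show ?thesis
      unfolding measure_reindex_law[OF measurable_g] P'_def to_measure_pushforward[OF borel_measurable_discretise]
      using borel_measurable_discretise[of n]
      by (subst measure_distr) (auto simp: measurable_to_measure_iff vimage_def)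
  qed
  have m1: "measure L {b. b \<circ> fst_bits \<in> cyl s} = cyl_prob g1 M1 s" for s
  proof (rule LIMSEQ_unique[OF measure_reindex_LIMSEQ[OF Q L lim]])
    have "measure (law g (P' (r n))) {b. b \<circ> fst_bits \<in> cyl s} = cyl_prob g1 M1 s" if n: "length s \<le> n" for n
    proof -
      \<comment> \<open>A subsequence index dominates its position, so from \<open>length s\<close>
        on the discretisation leaves the bits tested by \<open>s\<close> unchanged and the sequence
        is constant.\<close>
      have "length s \<le> r n" using n seq_suble[OF r, of n] by simp
      then have "g1 (fst (marginals (discretise (r n) m))) \<in> cyl s \<longleftrightarrow> g1 (fst m) \<in> cyl s" for m
        using discretise(1)[of "r n" m] by (auto simp: code_prefix_def cyl_def)
      then have "measure (law g (P' (r n))) {b. b \<circ> fst_bits \<in> cyl s} = cyl_prob g1 (pushforward fst (R (r n))) s"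
        unfolding law_P' g_comp cyl_prob_def to_measure_pushforward[OF borel_measurable_fst_snd(1)]
        using sets_coding_cyl[OF codingD(1)[OF coding_g(1)], of s] borel_measurable_fst_snd(1)
        by (subst measure_distr) (auto simp: measurable_to_measure_iff vimage_def marginals_def)
      then show ?thesis using R by (simp add: couplings_def)
    qed
    then show "(\<lambda>n. measure (law g (P' (r n))) {b. b \<circ> fst_bits \<in> cyl s}) \<longlonglongrightarrow> cyl_prob g1 M1 s"
      by (intro tendsto_eventually eventually_sequentiallyI)
  qed
  have m2: "measure L {b. b \<circ> snd_bits \<in> cyl s} = cyl_prob g2 M2 s" for s
  proof (rule LIMSEQ_unique[OF measure_reindex_LIMSEQ[OF Q L lim]])
    have "measure (law g (P' (r n))) {b. b \<circ> snd_bits \<in> cyl s} = cyl_prob g2 M2 s" if n: "length s \<le> n" for n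
    proof -
      have "length s \<le> r n" using n seq_suble[OF r, of n] by simp
      then have "g2 (snd (marginals (discretise (r n) m))) \<in> cyl s \<longleftrightarrow> g2 (snd m) \<in> cyl s" for m
        using discretise(1)[of "r n" m] by (auto simp: code_prefix_def cyl_def)
      then have "measure (law g (P' (r n))) {b. b \<circ> snd_bits \<in> cyl s} = cyl_prob g2 (pushforward snd (R (r n))) s"
        unfolding law_P' g_comp cyl_prob_def to_measure_pushforward[OF borel_measurable_fst_snd(2)]
        using sets_coding_cyl[OF codingD(1)[OF coding_g(2)], of s] borel_measurable_fst_snd(2)
        by (subst measure_distr) (auto simp: measurable_to_measure_iff vimage_def marginals_def)
      then show ?thesis using R by (simp add: couplings_def)
    qed
    then show "(\<lambda>n. measure (law g (P' (r n))) {b. b \<circ> snd_bits \<in> cyl s}) \<longlonglongrightarrow> cyl_prob g2 M2 s"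
      by (intro tendsto_eventually eventually_sequentiallyI)
  qed
  have re: "(\<lambda>b. b \<circ> \<gamma>) \<in> L \<rightarrow>\<^sub>M cantor" for \<gamma>
    by (simp add: mL)
  have law1: "distr L cantor (\<lambda>b. b \<circ> fst_bits) = law g1 M1"
    by (rule distr_reindex_eq_law[OF L codingD(1)[OF coding_g(1)] m1])
  have law2: "distr L cantor (\<lambda>b. b \<circ> snd_bits) = law g2 M2"
    by (rule distr_reindex_eq_law[OF L codingD(1)[OF coding_g(2)] m2])
  have ae1: "AE b in L. g1 (\<psi>1 (b \<circ> fst_bits)) = b \<circ> fst_bits"
    using AE_distrD[OF re AE_coding[OF coding_g(1), of M1, folded law1]] .
  have ae2: "AE b in L. g2 (\<psi>2 (b \<circ> snd_bits)) = b \<circ> snd_bits"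
    using AE_distrD[OF re AE_coding[OF coding_g(2), of M2, folded law2]] .

  define z where "z b = array_of (b \<circ> even_bits)" for b
  have tz: "tame (\<lambda>b. array_of (b \<circ> \<gamma>) u)" for u \<gamma>
    by (rule tame_reindex[OF tame_array_of])
  have zg: "array_of (g \<pi> \<circ> even_bits) = cyl_prob h \<pi>" "array_of (g \<pi> \<circ> fst_bits) = cyl_prob h1 (pushforward fst \<pi>)"
    "array_of (g \<pi> \<circ> snd_bits) = cyl_prob h2 (pushforward snd \<pi>)" for \<pi>
    unfolding g_comp by (simp_all add: g1_def g2_def array_of_prob_code)
  have ca: "cyl_array (cyl_prob h \<pi>)" for \<pi>
    using cyl_array_measure[OF prob_space_law sets_law, OF codingD(1)[OF coding_h], of \<pi>]
    by (simp add: measure_law_cyl[OF codingD(1)[OF coding_h]] eta_contract_eq)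
  have marg: "(\<Sum>u\<in>lists_of N. of_bool (\<forall>i<length s. u ! \<gamma> i = s ! i) * cyl_prob h \<pi> u) =
      measure (law h \<pi>) {b. b \<circ> \<gamma> \<in> cyl s}" if "\<And>i. i < length s \<Longrightarrow> \<gamma> i < N" for N s \<gamma> \<pi>
    using measure_reindex_cyl[OF prob_space_law[OF codingD(1)[OF coding_h]] sets_law that]
    by (simp add: measure_law_cyl[OF codingD(1)[OF coding_h]])
  have "AE b in L. z b [] = 1"
    unfolding z_def using cyl_arrayD(1)[OF ca] by (intro limit_tame_eq[OF L lim] tz tame_const) (simp add: zg)
  moreover have "AE b in L. \<forall>u. z b u = z b (u @ [False]) + z b (u @ [True])"
    unfolding z_def AE_all_countable
    by (intro allI limit_tame_eq[OF L lim] tz tame_add) (unfold zg, rule cyl_arrayD(3)[OF ca])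
  ultimately have aez: "AE b in L. cyl_array (z b)"
  proof eventually_elim
    case (elim b)
    have "\<forall>u. 0 \<le> z b u"
      unfolding z_def by (intro allI array_of_nonneg)
    with elim show ?case
      unfolding cyl_array_def by blast
  qed
  have tm: "tame (\<lambda>b. \<Sum>u\<in>A. a u * z b u)" for A and a :: "bool list \<Rightarrow> real"
    unfolding z_def by (intro tame_sum tame_cmult tz)
  \<comment> \<open>The linear relation between an array and its first marginal;
    \<open>2 * length s\<close> bits of the plan code cover all positions used. There are countably
    many \<open>s\<close>, so one null set serves for all.\<close>
  have aem1: "AE b in L. \<forall>s. (\<Sum>u\<in>lists_of (2 * length s). of_bool (\<forall>i<length s. u ! (2 * i) = s ! i) * z b u) =
      array_of (b \<circ> fst_bits) s"
    unfolding AE_all_countable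
  proof (intro allI limit_tame_eq[OF L lim] tm tz)
    fix s \<pi>
    show "(\<Sum>u\<in>lists_of (2 * length s). of_bool (\<forall>i<length s. u ! (2 * i) = s ! i) * z (g \<pi>) u) =
      array_of (g \<pi> \<circ> fst_bits) s"
      unfolding z_def zg
      by (subst marg, simp, subst cyl_prob_marginal[where h = h])
        (auto simp: codingD[OF base_coding(1)] codingD[OF coding_h] borel_measurable_fst_snd pair_code_comp)
  qed
  have aem2: "AE b in L. \<forall>s. (\<Sum>u\<in>lists_of (2 * length s). of_bool (\<forall>i<length s. u ! Suc (2 * i) = s ! i) * z b u) =
      array_of (b \<circ> snd_bits) s"
    unfolding AE_all_countable
  proof (intro allI limit_tame_eq[OF L lim] tm tz)
    fix s \<pi>
    show "(\<Sum>u\<in>lists_of (2 * length s). of_bool (\<forall>i<length s. u ! Suc (2 * i) = s ! i) * z (g \<pi>) u) =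
      array_of (g \<pi> \<circ> snd_bits) s"
      unfolding z_def zg
      by (subst marg, simp, subst cyl_prob_marginal[where h = h])
        (auto simp: codingD[OF base_coding(2)] codingD[OF coding_h] borel_measurable_fst_snd pair_code_comp)
  qed

  define G where "G b = decode_prob \<phi> (z b)" for b
  \<comment> \<open>Gluing is applied for each fixed \<open>b\<close>, to the measure with array
    \<open>z b\<close>; its marginals are those coded by the marginal bits of the same
    \<open>b\<close>.\<close>
  have aeG: "AE b in L. G b \<in> couplings (\<psi>1 (b \<circ> fst_bits)) (\<psi>2 (b \<circ> snd_bits)) \<and> cyl_prob h (G b) = z b"
    using ae1 ae2 aez aem1 aem2
  proof eventually_elim
    case (elim b)
    define L' where "L' = cantor_measure (z b)"
    have L': "prob_space L'" "sets L' = sets cantor" "\<And>u. measure L' (cyl u) = z b u"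
      unfolding L'_def using prob_space_cantor_measure sets_cantor_measure measure_cantor_measure[OF elim(3)] by auto
    have arr: "array_of (b \<circ> fst_bits) = cyl_prob h1 (\<psi>1 (b \<circ> fst_bits))"
      "array_of (b \<circ> snd_bits) = cyl_prob h2 (\<psi>2 (b \<circ> snd_bits))"
      using arg_cong[OF elim(1), of array_of] arg_cong[OF elim(2), of array_of]
      by (simp_all only: g1_def g2_def array_of_prob_code)
    have 1: "measure L' {b. b \<circ> (\<lambda>i. 2 * i) \<in> cyl s} = cyl_prob h1 (\<psi>1 (b \<circ> fst_bits)) s" for s
      unfolding arr[symmetric] using elim(4) measure_reindex_cyl[OF L'(1,2), of s "\<lambda>i. 2 * i" "2 * length s"]
      by (simp add: L'(3))
    have 2: "measure L' {b. b \<circ> (\<lambda>i. Suc (2 * i)) \<in> cyl s} = cyl_prob h2 (\<psi>2 (b \<circ> snd_bits)) s" for s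
      unfolding arr[symmetric] using elim(5) measure_reindex_cyl[OF L'(1,2), of s "\<lambda>i. Suc (2 * i)" "2 * length s"]
      by (simp add: L'(3))
    show ?case
      using glue_couplings[OF base_coding L'(1,2) 1 2]
      by (auto simp: G_def decode_prob_def L'_def[symmetric] L'(3))
  qed
  have mG: "G \<in> L \<rightarrow>\<^sub>M borel"
    unfolding G_def z_def mL
    by (intro measurable_compose[OF measurable_reindex_cantor] measurable_compose[OF measurable_array_of]
        measurable_decode_prob codingD(2)[OF coding_h])
  define P where "P = of_measure (distr L borel G)"
  have toP: "to_measure P = distr L borel G"
    unfolding P_def using mG by (intro to_measure_of_measure L.prob_space_distr) auto
  have "pushforward (pushforward fst) P = M1"
  proof (rule borel_prob_eqI)
    have "to_measure (pushforward (pushforward fst) P) = distr L borel (pushforward fst \<circ> G)"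
      unfolding to_measure_pushforward[OF borel_measurable_pushforward_fst_snd(1)] toP
      using borel_measurable_pushforward_fst_snd(1) mG by (rule distr_distr)
    \<comment> \<open>By \<open>aeG\<close> the marginal of \<open>G b\<close> is almost surely the
      measure decoded from the marginal bits, whose law is already known.\<close>
    also have "\<dots> = distr L borel (\<psi>1 \<circ> (\<lambda>b. b \<circ> fst_bits))"
    proof (rule distr_cong_AE)
      show "AE b in L. (pushforward fst \<circ> G) b = (\<psi>1 \<circ> (\<lambda>b. b \<circ> fst_bits)) b"
        using aeG by eventually_elim (simp add: couplings_def)
    qed (use mG re borel_measurable_pushforward_fst_snd(1) codingD(2)[OF coding_g(1)] in \<open>auto intro: measurable_comp\<close>)
    also have "\<dots> = distr (law g1 M1) borel \<psi>1"
      unfolding law1[symmetric] using codingD(2)[OF coding_g(1)] re by (rule distr_distr[symmetric])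
    finally show "to_measure (pushforward (pushforward fst) P) = to_measure M1"
      by (simp add: distr_law[OF coding_g(1)])
  qed
  moreover have "pushforward (pushforward snd) P = M2"
  proof (rule borel_prob_eqI)
    have "to_measure (pushforward (pushforward snd) P) = distr L borel (pushforward snd \<circ> G)"
      unfolding to_measure_pushforward[OF borel_measurable_pushforward_fst_snd(2)] toP
      using borel_measurable_pushforward_fst_snd(2) mG by (rule distr_distr)
    also have "\<dots> = distr L borel (\<psi>2 \<circ> (\<lambda>b. b \<circ> snd_bits))"
    proof (rule distr_cong_AE)
      show "AE b in L. (pushforward snd \<circ> G) b = (\<psi>2 \<circ> (\<lambda>b. b \<circ> snd_bits)) b"
        using aeG by eventually_elim (simp add: couplings_def)
    qed (use mG re borel_measurable_pushforward_fst_snd(2) codingD(2)[OF coding_g(2)] in \<open>auto intro: measurable_comp\<close>)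
    also have "\<dots> = distr (law g2 M2) borel \<psi>2"
      unfolding law2[symmetric] using codingD(2)[OF coding_g(2)] re by (rule distr_distr[symmetric])
    finally show "to_measure (pushforward (pushforward snd) P) = to_measure M2"
      by (simp add: distr_law[OF coding_g(2)])
  qed
  ultimately have "P \<in> random_couplings M1 M2"
    by (simp add: random_couplings_def)
  moreover have "random_plan_cost c P \<le> t0"
  proof -
    have tc: "tame (\<lambda>b. array_cost n (z b))" for n
      unfolding array_cost_def by (rule tm)
    \<comment> \<open>The bound is proved at each truncation level \<open>n\<close>, where the
      integrand is tame and its integral converges; the supremum is taken last.\<close>
    have "random_plan_cost c P = (SUP n. \<integral>\<^sup>+b. ennreal (array_cost n (cyl_prob h (G b))) \<partial>L)"
      unfolding random_plan_cost_eq_SUP unfolding toP using mG borel_measurable_array_cost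
      by (auto intro!: SUP_cong nn_integral_distr)
    also have "\<dots> = (SUP n. \<integral>\<^sup>+b. ennreal (array_cost n (z b)) \<partial>L)"
      by (intro SUP_cong refl nn_integral_cong_AE eventually_mono[OF aeG]) simp
    also have "\<dots> \<le> t0"
    proof (rule SUP_least)
      fix n
      have "(\<integral>\<^sup>+b. ennreal (array_cost n (z b)) \<partial>L) = ennreal (\<integral>b. array_cost n (z b) \<partial>L)"
        by (intro nn_integral_eq_integral tame_integrable tc L)
          (auto simp: array_cost_def z_def array_of_nonneg intro!: sum_nonneg)
      also have "\<dots> \<le> t0 + ennreal 0"
      proof (rule LIMSEQ_le)
        show "(\<lambda>k. ennreal (\<integral>b. array_cost n (z b) \<partial>law g (P' (r k)))) \<longlonglongrightarrow> ennreal (\<integral>b. array_cost n (z b) \<partial>L)"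
          by (intro tendsto_ennrealI tame_integral_LIMSEQ[OF Q L lim tc])
        have "(\<lambda>k. 1 / real (Suc k)) \<longlonglongrightarrow> 0"
          using LIMSEQ_inverse_real_of_nat by (simp add: inverse_eq_divide)
        from LIMSEQ_subseq_LIMSEQ[OF this r] LIMSEQ_subseq_LIMSEQ[OF t r]
        show "(\<lambda>k. t (r k) + ennreal (1 / real (Suc (r k)))) \<longlonglongrightarrow> t0 + ennreal 0"
          unfolding comp_def by (intro tendsto_intros tendsto_ennrealI)
        \<comment> \<open>The truncated cost is dominated by the full one, and the push-forward by
          \<open>discretise k\<close> is undone; the tolerance integrates to itself because the mass
          is one.\<close>
        have "ennreal (\<integral>b. array_cost n (z b) \<partial>law g (P' k)) \<le> t k + ennreal (1 / real (Suc k))" for k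
        proof -
          interpret R: prob_space "to_measure (R k)" by simp
          have "ennreal (\<integral>b. array_cost n (z b) \<partial>law g (P' k)) = (\<integral>\<^sup>+b. ennreal (array_cost n (z b)) \<partial>law g (P' k))"
            by (intro nn_integral_eq_integral[symmetric] tame_integrable tc Q)
              (auto simp: array_cost_def z_def array_of_nonneg intro!: sum_nonneg)
          also have "\<dots> = (\<integral>\<^sup>+\<pi>. ennreal (array_cost n (cyl_prob h \<pi>)) \<partial>to_measure (P' k))"
            unfolding law_def using measurable_g tame_measurable[OF tc]
            by (subst nn_integral_distr) (auto simp: measurable_to_measure_iff z_def zg)
          also have "\<dots> \<le> (\<integral>\<^sup>+\<pi>. plan_cost c \<pi> \<partial>to_measure (P' k))"
            by (intro nn_integral_mono array_cost_le_plan_cost)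
          also have "\<dots> = (\<integral>\<^sup>+m. plan_cost c (discretise k m) \<partial>to_measure (R k))"
            unfolding P'_def to_measure_pushforward[OF borel_measurable_discretise]
            using borel_measurable_discretise borel_measurable_plan_cost
            by (intro nn_integral_distr) (auto simp: measurable_to_measure_iff)
          also have "\<dots> \<le> (\<integral>\<^sup>+m. ot_cost c (fst m) (snd m) + ennreal (1 / real (Suc k)) \<partial>to_measure (R k))"
            by (intro nn_integral_mono discretise(2))
          also have "\<dots> = (\<integral>\<^sup>+m. ot_cost c (fst m) (snd m) \<partial>to_measure (R k)) + ennreal (1 / real (Suc k))"
            using borel_measurable_ot_cost R.emeasure_space_1
            by (subst nn_integral_add) (auto simp: measurable_to_measure_iff)
          also have "\<dots> \<le> t k + ennreal (1 / real (Suc k))"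
            by (intro add_right_mono le)
          finally show ?thesis .
        qed
        then show "\<exists>N. \<forall>k\<ge>N. ennreal (\<integral>b. array_cost n (z b) \<partial>law g (P' (r k))) \<le> t (r k) + ennreal (1 / real (Suc (r k)))"
          by blast
      qed
      finally show "(\<integral>\<^sup>+b. ennreal (array_cost n (z b)) \<partial>L) \<le> t0" by simp
    qed
    finally show ?thesis .
  qed
  ultimately show ?thesis by blast
qed

end

section \<open>Attainment and the characterisation of optimal random couplings\<close>

lemma ex_enumerated_basis: "\<exists>U :: nat \<Rightarrow> 'a::second_countable_topology set. topological_basis (range U)"
proof -
  obtain B :: "'a set set" where B: "countable B" "topological_basis B"
    using ex_countable_basis by blast
  have "B \<noteq> {}"
    using topological_basisE[OF B(2) open_UNIV UNIV_I] by blast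
  then show ?thesis
    using B range_from_nat_into[of B] by metis
qed

lemma is_arg_min_iff_eq_INF:
  fixes f :: "'x \<Rightarrow> 'y::{complete_lattice, linorder}"
  shows "is_arg_min f (\<lambda>x. x \<in> S) x \<longleftrightarrow> x \<in> S \<and> f x = (INF x\<in>S. f x)"
proof
  assume "is_arg_min f (\<lambda>x. x \<in> S) x"
  then have "x \<in> S" "f x \<le> (INF x\<in>S. f x)"
    by (auto simp: is_arg_min_linorder intro: INF_greatest)
  then show "x \<in> S \<and> f x = (INF x\<in>S. f x)"
    by (simp add: antisym INF_lower)
qed (auto simp: is_arg_min_linorder intro: INF_lower)

text \<open>A finite integral can be subtracted: the difference has integral zero, and since
  \<open>f\<close> is finite almost everywhere a vanishing difference means equality.\<close>

lemma nn_integral_eq_imp_AE_eq: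
  assumes "f \<in> borel_measurable M" "g \<in> borel_measurable M" and le: "\<And>x. f x \<le> g x"
    and eq: "(\<integral>\<^sup>+x. g x \<partial>M) = (\<integral>\<^sup>+x. f x \<partial>M)" "(\<integral>\<^sup>+x. f x \<partial>M) < \<infinity>"
  shows "AE x in M. g x = f x"
proof -
  have "(\<integral>\<^sup>+x. g x - f x \<partial>M) = 0"
    using assms by (subst nn_integral_diff) auto
  then have "AE x in M. g x - f x = 0"
    using assms by (subst (asm) nn_integral_0_iff_AE) auto
  moreover have "AE x in M. f x \<noteq> \<infinity>"
    using assms(1) eq(2) by (intro nn_integral_noteq_infinite) auto
  ultimately show ?thesis
  proof eventually_elim
    case (elim x)
    then show ?case
      using le[of x] by (auto simp: ennreal_minus_eq_0 intro: antisym)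
  qed
qed

context coded_cost
begin

lemma lifted_cost_eq: "lifted_cost c = (\<lambda>m. ot_cost c (fst m) (snd m))"
  by (simp add: case_prod_beta fun_eq_iff)

lemma ot_cost_marginals_le: "ot_cost c (fst (marginals \<pi>)) (snd (marginals \<pi>)) \<le> plan_cost c \<pi>"
  unfolding ot_cost_def by (intro INF_lower) (simp add: couplings_def marginals_def)

lemma borel_measurable_ot_cost_marginals:
  "(\<lambda>\<pi>. ot_cost c (fst (marginals \<pi>)) (snd (marginals \<pi>))) \<in> borel_measurable borel"
  using measurable_compose[OF borel_measurable_marginals borel_measurable_ot_cost] .

lemma lifted_plan_cost_marginals:
  "plan_cost (lifted_cost c) (pushforward marginals P) =
     (\<integral>\<^sup>+\<pi>. ot_cost c (fst (marginals \<pi>)) (snd (marginals \<pi>)) \<partial>to_measure P)"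
  unfolding lifted_cost_eq to_measure_pushforward[OF borel_measurable_marginals]
  using borel_measurable_marginals borel_measurable_ot_cost
  by (intro nn_integral_distr) (auto simp: measurable_to_measure_iff)

lemma lifted_plan_cost_marginals_le:
  "plan_cost (lifted_cost c) (pushforward marginals P) \<le> random_plan_cost c P"
  unfolding lifted_plan_cost_marginals by (intro nn_integral_mono ot_cost_marginals_le)

lemma ot_cost_lifted_le:
  assumes "P \<in> random_couplings M1 M2"
  shows "ot_cost (lifted_cost c) M1 M2 \<le> plan_cost (lifted_cost c) (pushforward marginals P)"
  unfolding ot_cost_def[of _ M1 M2] by (intro INF_lower pushforward_marginals_in_couplings assms)

text \<open>The limit construction turns a minimizing sequence for the lifted problem into a random
  coupling of cost at most the infimum; the reverse inequality holds for every random coupling. In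
  particular its image under \<open>marginals\<close> attains the lifted minimum.\<close>

lemma ex_optimal_random_coupling:
  "\<exists>P\<in>random_couplings M1 M2. random_plan_cost c P = ot_cost (lifted_cost c) M1 M2"
proof -
  define K where "K = ot_cost (lifted_cost c) M1 M2"
  have "\<exists>R\<in>couplings M1 M2. plan_cost (lifted_cost c) R \<le> K + ennreal (1 / real (Suc n))" for n
  \<comment> \<open>An infinite \<open>K\<close> bounds the cost of any coupling, and one exists; a
    finite \<open>K\<close> allows a strict inequality.\<close>
  proof (cases "K = \<top>")
    case True
    then show ?thesis
      using couplings_nonempty[of M1 M2] by auto
  next
    case False
    then have "K < K + ennreal (1 / real (Suc n))"
      using ennreal_add_left_cancel_less[of K 0 "ennreal (1 / real (Suc n))"]
      by (simp del: ennreal_add_left_cancel_less)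
    then show ?thesis
      unfolding K_def ot_cost_def[of _ M1 M2] by (subst (asm) (1) INF_less_iff) (auto intro: less_imp_le)
  qed
  then obtain R where R: "\<And>n. R n \<in> couplings M1 M2"
    "\<And>n. plan_cost (lifted_cost c) (R n) \<le> K + ennreal (1 / real (Suc n))"
    by metis
  have "(\<lambda>n. 1 / real (Suc n)) \<longlonglongrightarrow> 0"
    using LIMSEQ_inverse_real_of_nat by (simp add: inverse_eq_divide)
  then have "(\<lambda>n. K + ennreal (1 / real (Suc n))) \<longlonglongrightarrow> K + ennreal 0"
    by (intro tendsto_intros tendsto_ennrealI)
  then obtain P where P: "P \<in> random_couplings M1 M2" "random_plan_cost c P \<le> K + ennreal 0"
    using ex_random_coupling_le[of R M1 M2 "\<lambda>n. K + ennreal (1 / real (Suc n))" "K + ennreal 0"] R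
    unfolding lifted_cost_eq by blast
  then show ?thesis
    using order_trans[OF ot_cost_lifted_le[OF P(1)] lifted_plan_cost_marginals_le]
    by (intro bexI[of _ P]) (auto simp: K_def intro: antisym)
qed

lemma ot_cost_lifted_eq_INF:
  "ot_cost (lifted_cost c) M1 M2 = (INF P\<in>random_couplings M1 M2. random_plan_cost c P)"
proof (rule antisym)
  show "ot_cost (lifted_cost c) M1 M2 \<le> (INF P\<in>random_couplings M1 M2. random_plan_cost c P)"
    by (intro INF_greatest order_trans[OF ot_cost_lifted_le lifted_plan_cost_marginals_le])
  show "(INF P\<in>random_couplings M1 M2. random_plan_cost c P) \<le> ot_cost (lifted_cost c) M1 M2"
    using ex_optimal_random_coupling[of M1 M2] by (auto intro: INF_lower2)
qed

text \<open>The lifted cost of the image of \<open>P\<close> lies between the infimum and the cost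
  of \<open>P\<close>. Equality with the infimum is optimality of the image; equality with the cost
  of \<open>P\<close>, the integrals being finite, is almost sure optimality of the plans.\<close>

lemma optimal_random_coupling_iff:
  assumes fin: "ot_cost (lifted_cost c) M1 M2 < \<infinity>" and P: "P \<in> random_couplings M1 M2"
  shows "is_arg_min (random_plan_cost c) (\<lambda>P. P \<in> random_couplings M1 M2) P \<longleftrightarrow>
    pushforward marginals P \<in> optimal_couplings (lifted_cost c) M1 M2 \<and>
    (AE \<pi> in to_measure P. \<pi> \<in> optimal_plans c)" (is "?lhs \<longleftrightarrow> ?opt \<and> ?ae")
proof -
  let ?R = "pushforward marginals P" and ?K = "ot_cost (lifted_cost c) M1 M2"
  have lhs: "?lhs \<longleftrightarrow> random_plan_cost c P = ?K"
    using P by (simp add: is_arg_min_iff_eq_INF ot_cost_lifted_eq_INF)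
  have opt: "?opt \<longleftrightarrow> plan_cost (lifted_cost c) ?R = ?K"
    using pushforward_marginals_in_couplings[OF P]
    by (simp add: optimal_couplings_def is_arg_min_iff_eq_INF ot_cost_def[of _ M1 M2])
  have ae: "?ae \<longleftrightarrow> (AE \<pi> in to_measure P. plan_cost c \<pi> = ot_cost c (fst (marginals \<pi>)) (snd (marginals \<pi>)))"
    by (simp add: optimal_plans_def marginals_def)
  show ?thesis
  proof
    assume ?lhs
    then have "random_plan_cost c P = ?K" by (simp add: lhs)
    then have R: "plan_cost (lifted_cost c) ?R = ?K"
      using ot_cost_lifted_le[OF P] lifted_plan_cost_marginals_le[of P] by (auto intro: antisym)
    moreover have ?ae
      unfolding ae
      using R \<open>random_plan_cost c P = ?K\<close> fin lifted_plan_cost_marginals[of P] ot_cost_marginals_le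
        borel_measurable_plan_cost borel_measurable_ot_cost_marginals
      by (intro nn_integral_eq_imp_AE_eq) (auto simp: measurable_to_measure_iff)
    ultimately show "?opt \<and> ?ae" by (simp add: opt)
  next
    assume *: "?opt \<and> ?ae"
    then have "random_plan_cost c P = (\<integral>\<^sup>+\<pi>. ot_cost c (fst (marginals \<pi>)) (snd (marginals \<pi>)) \<partial>to_measure P)"
      unfolding ae by (intro nn_integral_cong_AE) simp
    with * show ?lhs
      unfolding lhs opt lifted_plan_cost_marginals by simp
  qed
qed

end

theorem lemma3p2:
  fixes c :: "'a::polish_space \<times> 'b::polish_space \<Rightarrow> ennreal"
    and M1 :: "'a borel_prob borel_prob"
    and M2 :: "'b borel_prob borel_prob"
  assumes "lower_semicontinuous c"
    and "\<exists>z. c z \<noteq> \<infinity>"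
  shows
    "(\<forall>P \<in> random_couplings M1 M2.
        pushforward marginals P \<in> couplings M1 M2 \<and>
        (\<integral>\<^sup>+(\<mu>, \<nu>). ot_cost c \<mu> \<nu> \<partial>to_measure (pushforward marginals P))
          \<le> (\<integral>\<^sup>+\<pi>. (\<integral>\<^sup>+z. c z \<partial>to_measure \<pi>) \<partial>to_measure P)) \<and>
     ot_cost (lifted_cost c) M1 M2 = (INF P\<in>random_couplings M1 M2. random_plan_cost c P) \<and>
     (\<exists>P. is_arg_min (random_plan_cost c) (\<lambda>P. P \<in> random_couplings M1 M2) P) \<and>
     (ot_cost (lifted_cost c) M1 M2 < \<infinity> \<longrightarrow>
       (\<forall>P \<in> random_couplings M1 M2.
          is_arg_min (random_plan_cost c) (\<lambda>P. P \<in> random_couplings M1 M2) P \<longleftrightarrow>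
            pushforward marginals P \<in> optimal_couplings (lifted_cost c) M1 M2 \<and>
            (AE \<pi> in to_measure P. \<pi> \<in> optimal_plans c)))"
proof -
  obtain U :: "nat \<Rightarrow> 'a set" where U: "topological_basis (range U)"
    using ex_enumerated_basis by blast
  obtain V :: "nat \<Rightarrow> 'b set" where V: "topological_basis (range V)"
    using ex_enumerated_basis by blast
  obtain \<phi>1 \<phi>2 where "coding (base_code U) \<phi>1" "coding (base_code V) \<phi>2"
    using ex_base_decode[OF U] ex_base_decode[OF V] by blast
  with assms(1) U V interpret coded_cost c U V \<phi>1 \<phi>2
    by unfold_locales
  have "\<exists>P. is_arg_min (random_plan_cost c) (\<lambda>P. P \<in> random_couplings M1 M2) P"
    using ex_optimal_random_coupling[of M1 M2]
    by (auto simp: is_arg_min_iff_eq_INF simp flip: ot_cost_lifted_eq_INF)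
  then show ?thesis
    using pushforward_marginals_in_couplings lifted_plan_cost_marginals_le ot_cost_lifted_eq_INF
      optimal_random_coupling_iff by blast
qed

end
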